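(* Fix $\varepsilon\in(0,\varepsilon_{\max})$, write $\Omega=\Omega_\varepsilon$, $\mathbf B=\mathbf B_\varepsilon$, $\lambda=\lambda_R(\cdot;\varepsilon)$, and let $v\in\mathbb R$. Let $f$ satisfy the regularity condition stated in the context. If $\int_{-\infty}^v\lambda<+\infty$ and $\lim_{t\to-\infty}f(t)=+\infty$, then $\mathbf B(x;f)=+\infty$ for every $x\in\Omega\setminus\partial_{\rm fixed}\Omega$.
   Context: Domains. Let $0<\varepsilon_{\max}\le\infty$ and let $\mathbf g(\cdot;\varepsilon)=(\mathbf g_1,\mathbf g_2):\mathbb R\to\mathbb R^2$, $0\le\varepsilon<\varepsilon_{\max}$, be $C^3$ curves, $C^{3,1}$-smooth in $(t,\varepsilon)$ (the mixed derivative $\partial_t^3\partial_\varepsilon\mathbf g$ is continuous), such that for every $\varepsilon$ (primes denote $\partial_t$) $\mathbf g_1'>0$ and $\mathbf g_2''\mathbf g_1'-\mathbf g_2'\mathbf g_1''>0$. Put $g(t)=(g_1(t),g_2(t))=\mathbf g(t;0)$ and $\Xi_\varepsilon=\{(\mathbf g_1(t;\varepsilon),x_2):t\in\mathbb R,\ x_2>\mathbf g_2(t;\varepsilon)\}$. Assume that for $\varepsilon_1<\varepsilon_2$ one has $\Xi_{\varepsilon_1}\supset\Xi_{\varepsilon_2}$ and $\mathbf g(t;\varepsilon_1)\notin\overline{\Xi_{\varepsilon_2}}$ for all $t$. Assume that for every $\varepsilon\in(0,\varepsilon_{\max})$ and $t\in\mathbb R$ there are two tangent lines from $g(t)$ to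 $\Xi_\varepsilon$, each meeting the curve $g(\cdot)$ twice. Let $w_L(t;\varepsilon)=\mathbf g(s_L;\varepsilon)$ and $w_R(t;\varepsilon)=\mathbf g(s_R;\varepsilon)$, $s_R<s_L$, be the tangency points, $S_L(t;\varepsilon)=[g(t),w_L(t;\varepsilon)]$, $S_R(t;\varepsilon)=[g(t),w_R(t;\varepsilon)]$ the tangent segments, and $\kappa_L,\kappa_R$ their slopes; assume $\partial_\varepsilon\kappa_L\ne0$, $\partial_\varepsilon\kappa_R\neq 0$ everywhere. Let $T_\varepsilon(t)$ be the closed curvilinear triangle with vertex $g(t)$ bounded by $S_L(t;\varepsilon)$, $S_R(t;\varepsilon)$ and the arc of $\mathbf g(\cdot;\varepsilon)$ between the two tangency points, and $\Omega_\varepsilon=\bigcup_{t}T_\varepsilon(t)$. The fixed boundary is $\partial_{\rm fixed}\Omega_\varepsilon=g(\mathbb R)$. The scalar function $\lambda_R(t;\varepsilon)>0$ is defined by $\lambda_R(t)(g(t)-w_R(t))=w_R'(t)$. Regularity condition on $f:\mathbb R\to\mathbb R$: $f\in C^2(\mathbb R)$ and $\mathfrak K=\kappa_3'/\kappa_2'$ is piecewise monotone with finitely many monotonicity intervals, where $\kappa_2=g_2'/g_1'$, $\kappa_3=f'/g_1'$. Bellman function. For an interval $I$, $\mathbf A_{\Omega_\varepsilon}(I)$ is the class of summable $\varphi:I\to\partial_{\rm fixed}\Omega_\varepsilon$ with average $\langle\varphi\rangle_J\in\Omega_\varepsilon$ for every subinterval $J\subset I$. Let $\mathrm f(g(t))=f(t)$;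 $\mathbf B_\varepsilon(x;f)=\sup\{\langle \mathrm f(\varphi)\rangle_I:\ \langle\varphi\rangle_I=x,\ \varphi\in\mathbf A_{\Omega_\varepsilon}(I)\}$ (independent of $I$), the supremum being over those $\varphi$ for which the average makes sense in $[-\infty,+\infty]$. *)

theory Defs
  imports "HOL-Analysis.Analysis"
begin

text \<open>
  A family of plane curves is a function \<open>G\<close> with \<open>G t e\<close> the point with parameter \<open>t\<close> on the
  curve number \<open>e\<close>. The curve \<open>e = 0\<close> is the fixed boundary.
\<close>

type_synonym curves = "real \<Rightarrow> real \<Rightarrow> real \<times> real"

definition x1 :: "curves \<Rightarrow> real \<Rightarrow> real \<Rightarrow> real" where
  "x1 G e = (\<lambda>t. fst (G t e))"

definition x2 :: "curves \<Rightarrow> real \<Rightarrow> real \<Rightarrow> real" where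
  "x2 G e = (\<lambda>t. snd (G t e))"

definition params :: "ereal \<Rightarrow> real set" where
  "params emax = {e. 0 \<le> e \<and> ereal e < emax}"

text \<open>
  In the next definition \<open>D i j\<close> is the partial derivative of order \<open>i\<close> in \<open>t\<close> and \<open>j\<close> in the
  parameter; derivatives in the parameter are one-sided at the end point of \<open>E\<close>.
\<close>

definition C31_smooth :: "curves \<Rightarrow> real set \<Rightarrow> bool" where
  "C31_smooth G E \<longleftrightarrow>
    (\<exists>D :: nat \<Rightarrow> nat \<Rightarrow> real \<Rightarrow> real \<Rightarrow> real \<times> real.
      (\<forall>t. \<forall>e\<in>E. D 0 0 t e = G t e) \<and>
      (\<forall>i<3. \<forall>j\<le>1. \<forall>t. \<forall>e\<in>E.
         ((\<lambda>s. D i j s e) has_vector_derivative D (Suc i) j t e) (at t)) \<and>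
      (\<forall>i\<le>3. \<forall>t. \<forall>e\<in>E.
         ((\<lambda>d. D i 0 t d) has_vector_derivative D i 1 t e) (at e within E)) \<and>
      (\<forall>i\<le>3. \<forall>j\<le>1. continuous_on (UNIV \<times> E) (\<lambda>(t, e). D i j t e)))"

definition Xi :: "curves \<Rightarrow> real \<Rightarrow> (real \<times> real) set" where
  "Xi G e = {(x1 G e t, y) | t y. y > x2 G e t}"

definition tangent_line :: "curves \<Rightarrow> real \<Rightarrow> real \<Rightarrow> (real \<times> real) set" where
  "tangent_line G e s = {G s e + r *\<^sub>R vector_derivative (\<lambda>u. G u e) (at s) | r. True}"

text \<open>
  The tangent lines from \<open>p\<close> to \<open>Xi G e\<close>, given by the parameters of their points of tangency;
  by strict convexity of the curve, different parameters give different lines.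
\<close>

definition tangency_params :: "curves \<Rightarrow> real \<Rightarrow> real \<times> real \<Rightarrow> real set" where
  "tangency_params G e p = {s. p \<in> tangent_line G e s}"

definition s_R :: "curves \<Rightarrow> real \<Rightarrow> real \<Rightarrow> real" where
  "s_R G t e = Min (tangency_params G e (G t 0))"

definition s_L :: "curves \<Rightarrow> real \<Rightarrow> real \<Rightarrow> real" where
  "s_L G t e = Max (tangency_params G e (G t 0))"

definition w_R :: "curves \<Rightarrow> real \<Rightarrow> real \<Rightarrow> real \<times> real" where
  "w_R G t e = G (s_R G t e) e"

definition w_L :: "curves \<Rightarrow> real \<Rightarrow> real \<Rightarrow> real \<times> real" where
  "w_L G t e = G (s_L G t e) e"

definition slope :: "real \<times> real \<Rightarrow> real \<times> real \<Rightarrow> real" where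
  "slope p q = (snd q - snd p) / (fst q - fst p)"

definition kappa_R :: "curves \<Rightarrow> real \<Rightarrow> real \<Rightarrow> real" where
  "kappa_R G t e = slope (G t 0) (w_R G t e)"

definition kappa_L :: "curves \<Rightarrow> real \<Rightarrow> real \<Rightarrow> real" where
  "kappa_L G t e = slope (G t 0) (w_L G t e)"

locale domain_family =
  fixes G :: curves and emax :: ereal
  assumes emax_pos: "0 < emax"
    and smooth: "C31_smooth G (params emax)"
    and x1_deriv_pos: "e \<in> params emax \<Longrightarrow> deriv (x1 G e) t > 0"
    and curvature_pos: "e \<in> params emax \<Longrightarrow>
      deriv (deriv (x2 G e)) t * deriv (x1 G e) t - deriv (x2 G e) t * deriv (deriv (x1 G e)) t > 0"
    and Xi_decreasing: "\<lbrakk>e1 \<in> params emax; e2 \<in> params emax; e1 < e2\<rbrakk> \<Longrightarrow> Xi G e2 \<subseteq> Xi G e1"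
    and Xi_separated: "\<lbrakk>e1 \<in> params emax; e2 \<in> params emax; e1 < e2\<rbrakk> \<Longrightarrow> G t e1 \<notin> closure (Xi G e2)"
    and two_tangents: "\<lbrakk>e \<in> params emax; 0 < e\<rbrakk> \<Longrightarrow> card (tangency_params G e (G t 0)) = 2"
    and tangents_meet_twice: "\<lbrakk>e \<in> params emax; 0 < e; s \<in> tangency_params G e (G t 0)\<rbrakk> \<Longrightarrow>
      card {u. G u 0 \<in> tangent_line G e s} = 2"
    and kappa_R_deriv: "\<lbrakk>e \<in> params emax; 0 < e\<rbrakk> \<Longrightarrow>
      kappa_R G t differentiable at e \<and> deriv (kappa_R G t) e \<noteq> 0"
    and kappa_L_deriv: "\<lbrakk>e \<in> params emax; 0 < e\<rbrakk> \<Longrightarrow>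
      kappa_L G t differentiable at e \<and> deriv (kappa_L G t) e \<noteq> 0"

text \<open>
  The sides of the curvilinear triangle issuing from the vertex are tangent to the convex set
  \<open>Xi G e\<close>, so the arc between the tangency points lies in the rectilinear triangle with the
  same vertices and cuts off from it exactly the points of \<open>Xi G e\<close>.
\<close>

definition curvilinear_triangle :: "curves \<Rightarrow> real \<Rightarrow> real \<Rightarrow> (real \<times> real) set" where
  "curvilinear_triangle G e t = convex hull {G t 0, w_L G t e, w_R G t e} - Xi G e"

definition Omega :: "curves \<Rightarrow> real \<Rightarrow> (real \<times> real) set" where
  "Omega G e = (\<Union>t. curvilinear_triangle G e t)"

definition fixed_boundary :: "curves \<Rightarrow> (real \<times> real) set" where
  "fixed_boundary G = range (\<lambda>t. G t 0)"

definition lambda_R :: "curves \<Rightarrow> real \<Rightarrow> real \<Rightarrow> real" where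
  "lambda_R G e t =
    (THE l. l *\<^sub>R (G t 0 - w_R G t e) = vector_derivative (\<lambda>s. w_R G s e) (at t))"

definition kappa2 :: "curves \<Rightarrow> real \<Rightarrow> real" where
  "kappa2 G t = deriv (x2 G 0) t / deriv (x1 G 0) t"

definition kappa3 :: "curves \<Rightarrow> (real \<Rightarrow> real) \<Rightarrow> real \<Rightarrow> real" where
  "kappa3 G f t = deriv f t / deriv (x1 G 0) t"

definition torsion :: "curves \<Rightarrow> (real \<Rightarrow> real) \<Rightarrow> real \<Rightarrow> real" where
  "torsion G f t = deriv (kappa3 G f) t / deriv (kappa2 G) t"

definition piecewise_monotone :: "(real \<Rightarrow> real) \<Rightarrow> bool" where
  "piecewise_monotone h \<longleftrightarrow>
    (\<exists>P. finite P \<and>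
      (\<forall>J. is_interval J \<and> J \<inter> P = {} \<longrightarrow>
         monotone_on J (\<le>) (\<le>) h \<or> monotone_on J (\<le>) (\<ge>) h))"

definition regular_boundary_value :: "curves \<Rightarrow> (real \<Rightarrow> real) \<Rightarrow> bool" where
  "regular_boundary_value G f \<longleftrightarrow>
    f differentiable_on UNIV \<and> deriv f differentiable_on UNIV \<and>
    continuous_on UNIV (deriv (deriv f)) \<and>
    piecewise_monotone (torsion G f)"

definition average :: "real \<Rightarrow> real \<Rightarrow> (real \<Rightarrow> real \<times> real) \<Rightarrow> real \<times> real" where
  "average a b \<phi> = (1 / (b - a)) *\<^sub>R (LINT t:{a..b}|lborel. \<phi> t)"

definition admissible :: "curves \<Rightarrow> real \<Rightarrow> real \<Rightarrow> real \<Rightarrow> (real \<Rightarrow> real \<times> real) \<Rightarrow> bool" where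
  "admissible G e a b \<phi> \<longleftrightarrow>
    set_integrable lborel {a..b} \<phi> \<and>
    (\<forall>t\<in>{a..b}. \<phi> t \<in> fixed_boundary G) \<and>
    (\<forall>c d. a \<le> c \<and> c < d \<and> d \<le> b \<longrightarrow> average c d \<phi> \<in> Omega G e)"

definition on_boundary :: "curves \<Rightarrow> (real \<Rightarrow> real) \<Rightarrow> real \<times> real \<Rightarrow> real" where
  "on_boundary G f p = f (THE t. G t 0 = p)"

text \<open>Averages with values in \<open>[-\<infinity>, \<infinity>]\<close>.\<close>

definition pos_integral :: "real \<Rightarrow> real \<Rightarrow> (real \<Rightarrow> real) \<Rightarrow> ennreal" where
  "pos_integral a b h = (\<integral>\<^sup>+t\<in>{a..b}. ennreal (h t) \<partial>lborel)"

definition has_ext_average :: "real \<Rightarrow> real \<Rightarrow> (real \<Rightarrow> real) \<Rightarrow> bool" where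
  "has_ext_average a b h \<longleftrightarrow>
    set_borel_measurable lborel {a..b} h \<and>
    (pos_integral a b h < \<infinity> \<or> pos_integral a b (\<lambda>t. - h t) < \<infinity>)"

definition ext_average :: "real \<Rightarrow> real \<Rightarrow> (real \<Rightarrow> real) \<Rightarrow> ereal" where
  "ext_average a b h =
    (enn2ereal (pos_integral a b h) - enn2ereal (pos_integral a b (\<lambda>t. - h t))) / ereal (b - a)"

text \<open>The Bellman function computed on the interval \<open>[a, b]\<close>.\<close>

definition bellman ::
  "curves \<Rightarrow> real \<Rightarrow> real \<Rightarrow> real \<Rightarrow> (real \<Rightarrow> real) \<Rightarrow> real \<times> real \<Rightarrow> ereal" where
  "bellman G e a b f x =
    Sup {ext_average a b (\<lambda>t. on_boundary G f (\<phi> t)) | \<phi>.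
      admissible G e a b \<phi> \<and> average a b \<phi> = x \<and>
      has_ext_average a b (\<lambda>t. on_boundary G f (\<phi> t))}"

end

theory Submission
  imports Defs
begin

text \<open>
  Write \<open>g(t) = G t 0\<close> for the fixed boundary and \<open>w(t) = w_R G t e\<close> for the right tangency point.
  As \<open>t\<close> grows, the tangency point moves along the tangent line, that is, towards \<open>g(t)\<close>:
  \<open>w' = \<lambda> (g - w)\<close>. Hence if \<open>m' = \<lambda> m\<close>, then \<open>(m w)' = m' g\<close>. In terms of masses: put a mass
  \<open>m(n)\<close> with barycentre \<open>w(n)\<close> somewhere, and then add the mass \<open>m'(t) dt\<close> at \<open>g(t)\<close> for \<open>t\<close> from
  \<open>n\<close> to \<open>V\<close>; the barycentre follows the tangency point and arrives at \<open>w(V)\<close>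
  (\<open>tangent_spiral\<close>). Normalised by \<open>m(V) = 1\<close>, the initial mass is
  \<open>exp (- \<integral>\<^bsub>n\<^esub>\<^bsup>V\<^esup> \<lambda>)\<close>, and convergence of the integral of \<open>\<lambda>\<close> at \<open>-\<infinity>\<close> keeps it away from zero
  when \<open>n \<rightarrow> -\<infinity>\<close>. The initial mass is placed at the two points where the tangent at \<open>w(n)\<close> meets
  the fixed boundary. Both have parameter at most \<open>n\<close>, so \<open>f\<close> is arbitrarily large there,
  whereas \<open>f\<close> is bounded below on all of \<open>(-\<infinity>, V]\<close>; so the average of \<open>f\<close> tends to infinity.
  A further mass at \<open>g(V)\<close> moves the barycentre along the segment from \<open>w(V)\<close> to
  \<open>g(V)\<close> (\<open>test_function\<close>), and these segments cover the domain without its fixed boundary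
  (\<open>right_tangents_cover\<close>).

  What has to be checked is that the functions obtained in this way are admissible, i.e. that
  averages over arbitrary subintervals stay in the domain. The tool is the height of a point above
  the tangent to the upper curve at parameter \<open>s\<close>. It is affine in the point, so it commutes with
  averaging, and its derivative in \<open>s\<close> has the sign of \<open>X(s) - x\<close>, where \<open>x\<close> is the abscissa of the
  point and \<open>X(s)\<close> that of the tangency point. A point above the fixed boundary lies in
  the domain as soon as it has height zero over one right tangent (\<open>chord_in_Omega\<close>). Since the
  parameter is nondecreasing along the test function, an average over \<open>[c, d]\<close> has nonnegative
  height over the right tangent belonging to \<open>c\<close> and nonpositive height over the one belonging to
  \<open>d\<close>, and the right tangents depend continuously on their parameter
  (\<open>monotone_function_admissible\<close>).
\<close>

section \<open>Real functions and averages over intervals\<close>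

lemma less_of_deriv_pos:
  fixes h h' :: "real \<Rightarrow> real"
  assumes "u < w" and "\<And>t. (h has_real_derivative h' t) (at t)"
    and "\<And>t. u < t \<Longrightarrow> t < w \<Longrightarrow> h' t > 0"
  shows "h u < h w"
proof -
  obtain z where "u < z" "z < w" "h w - h u = (w - u) * h' z"
    using MVT2[OF assms(1), of h h'] assms(2) by blast
  then show ?thesis using assms(1) assms(3)[of z]
    by (metis diff_gt_0_iff_gt mult_pos_pos)
qed

lemma has_integral_average:
  assumes "set_integrable lborel {a..b} \<phi>" "a \<le> c" "c < d" "d \<le> b"
  shows "(\<phi> has_integral (d - c) *\<^sub>R average c d \<phi>) {c..d}"
proof -
  have "set_integrable lborel {c..d} \<phi>"
    by (rule set_integrable_subset[OF assms(1)]) (use assms in auto)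
  from set_borel_integral_eq_integral[OF this] show ?thesis
    using assms(3) by (simp add: average_def has_integral_iff)
qed

lemma zero_between:
  fixes h :: "real \<Rightarrow> real"
  assumes "continuous_on UNIV h" "h p \<ge> 0" "h q \<le> 0"
  shows "\<exists>r. h r = 0"
  using assms IVT'[of h q 0 p] IVT2'[of h q 0 p] continuous_on_subset[OF assms(1)]
  by (cases "p \<le> q") auto

lemma set_integrable_along_bounded_mono:
  fixes \<gamma> :: "real \<Rightarrow> real \<times> real" and U :: "real \<Rightarrow> real"
  assumes "mono U" and bounds: "\<And>z. l \<le> U z" "\<And>z. U z \<le> u" and cont: "continuous_on UNIV \<gamma>"
  shows "set_integrable lborel {a..b} (\<lambda>z. \<gamma> (U z))"
proof -
  have "compact (\<gamma> ` {l..u})"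
    by (intro compact_continuous_image continuous_on_subset[OF cont]) auto
  then obtain B where "\<forall>y\<in>\<gamma> ` {l..u}. norm y \<le> B"
    using compact_imp_bounded bounded_iff by blast
  then have B: "norm (\<gamma> t) \<le> B" if "t \<in> {l..u}" for t using that by blast
  have [measurable]: "(\<lambda>z. \<gamma> (U z)) \<in> borel_measurable borel"
    by (rule measurable_compose[OF borel_measurable_mono[OF assms(1)] borel_measurable_continuous_onI[OF cont]])
  show ?thesis
    unfolding set_integrable_def
    by (rule integrableI_bounded_set[where A = "{a..b}" and B = B])
      (use B bounds in \<open>auto simp: indicator_def emeasure_lborel_Icc_eq\<close>)
qed

text \<open>
  The bound from below makes the integral of the negative part finite, so the extended average is
  meaningful and dominates the one of the step function with values \<open>M\<close> and \<open>- B\<close>, up to counting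
  \<open>- B\<close> on the initial piece as well.
\<close>

lemma ext_average_bounds:
  assumes "a < b" "a \<le> c" "c \<le> b" "0 \<le> M" "0 \<le> B" and meas: "h \<in> borel_measurable borel"
    and M: "\<And>z. z < c \<Longrightarrow> M \<le> h z" and B: "\<And>z. - B \<le> h z"
  shows "has_ext_average a b h"
    and "ereal ((M * (c - a) - B * (b - a)) / (b - a)) \<le> ext_average a b h"
proof -
  have neg: "pos_integral a b (\<lambda>t. - h t) \<le> ennreal (B * (b - a))"
  proof -
    have "pos_integral a b (\<lambda>t. - h t) \<le> (\<integral>\<^sup>+t. ennreal B * indicator {a..b} t \<partial>lborel)"
      unfolding pos_integral_def using B
      by (intro nn_integral_mono) (auto split: split_indicator intro!: ennreal_leI simp: minus_le_iff)
    also have "\<dots> = ennreal (B * (b - a))"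
      using assms(1,5) by (simp add: nn_integral_cmult_indicator ennreal_mult)
    finally show ?thesis .
  qed
  have pos: "ennreal (M * (c - a)) \<le> pos_integral a b h"
  proof -
    have "ennreal (M * (c - a)) = (\<integral>\<^sup>+t. ennreal M * indicator {a..<c} t \<partial>lborel)"
      using assms(2,4) by (simp add: nn_integral_cmult_indicator ennreal_mult)
    also have "\<dots> \<le> pos_integral a b h"
      unfolding pos_integral_def using M assms(3)
      by (intro nn_integral_mono) (auto split: split_indicator intro!: ennreal_leI)
    finally show ?thesis .
  qed
  have "set_borel_measurable lborel {a..b} h"
    unfolding set_borel_measurable_def using meas by simp
  moreover have "pos_integral a b (\<lambda>t. - h t) < \<infinity>"
    using neg by (simp add: order_le_less_trans)
  ultimately show "has_ext_average a b h" by (simp add: has_ext_average_def)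
  have "ereal (M * (c - a)) \<le> enn2ereal (pos_integral a b h)"
    using pos assms(2,4) unfolding less_eq_ennreal.rep_eq by (simp add: enn2ereal_ennreal)
  moreover have "enn2ereal (pos_integral a b (\<lambda>t. - h t)) \<le> ereal (B * (b - a))"
    using neg assms(1,5) unfolding less_eq_ennreal.rep_eq by (simp add: enn2ereal_ennreal)
  ultimately have "ereal (M * (c - a)) - ereal (B * (b - a)) \<le>
      enn2ereal (pos_integral a b h) - enn2ereal (pos_integral a b (\<lambda>t. - h t))"
    by (rule ereal_minus_mono)
  then have "(ereal (M * (c - a)) - ereal (B * (b - a))) / ereal (b - a) \<le> ext_average a b h"
    unfolding ext_average_def using assms(1) by (intro ereal_divide_right_mono) auto
  then show "ereal ((M * (c - a) - B * (b - a)) / (b - a)) \<le> ext_average a b h"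
    using assms(1) by simp
qed

section \<open>Strictly convex curves and the height above a tangent\<close>

text \<open>
  Here \<open>K\<close> is the slope of the tangent as a function of the parameter. Strict convexity of the graph
  is the positivity of \<open>K'\<close>.
\<close>

locale convex_curve =
  fixes X Y X' K K' :: "real \<Rightarrow> real"
  assumes X_deriv: "(X has_real_derivative X' t) (at t)"
    and X'_pos: "X' t > 0"
    and Y_deriv: "(Y has_real_derivative K t * X' t) (at t)"
    and K_deriv: "(K has_real_derivative K' t) (at t)"
    and K'_pos: "K' t > 0"
    and X'_cont: "continuous_on UNIV X'"
    and K'_cont: "continuous_on UNIV K'"
begin

text \<open>
  The signed vertical distance from the tangent at \<open>s\<close> to the point \<open>p\<close>. Unlike a distance, it is
  affine in \<open>p\<close>, and differentiating it in \<open>s\<close> leaves only the term with \<open>K'\<close>.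
\<close>

definition height :: "real \<Rightarrow> real \<times> real \<Rightarrow> real" where
  "height s p = snd p - Y s - K s * (fst p - X s)"

lemma X_less_iff: "X u < X w \<longleftrightarrow> u < w"
  using less_of_deriv_pos[OF _ X_deriv X'_pos] by (metis less_irrefl linorder_neqE_linordered_idom order.strict_trans)

lemma X_le_iff: "X u \<le> X w \<longleftrightarrow> u \<le> w"
  using X_less_iff by (meson linorder_not_le)

lemma X_eq_iff: "X u = X w \<longleftrightarrow> u = w"
  using X_le_iff by (metis order_antisym order_refl)

lemma K_less: "u < w \<Longrightarrow> K u < K w"
  using less_of_deriv_pos[OF _ K_deriv K'_pos] by blast

lemma X_cont: "continuous_on A X"
  using X_deriv by (meson DERIV_isCont continuous_at_imp_continuous_on)

lemma Y_cont: "continuous_on A Y"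
  using Y_deriv by (meson DERIV_isCont continuous_at_imp_continuous_on)

lemma K_cont: "continuous_on A K"
  using K_deriv by (meson DERIV_isCont continuous_at_imp_continuous_on)

lemma height_cont: "continuous_on A (\<lambda>s. height s p)"
  unfolding height_def by (intro continuous_intros X_cont Y_cont K_cont)

lemma height_affine:
  "height s ((1 - r) *\<^sub>R p + r *\<^sub>R q) = (1 - r) * height s p + r * height s q"
  unfolding height_def by (simp add: algebra_simps)

lemma line_minus_curve_deriv:
  "((\<lambda>u. Y u - \<kappa> * X u - c) has_real_derivative X' t * (K t - \<kappa>)) (at t)"
  by (auto intro!: derivative_eq_intros X_deriv Y_deriv simp: algebra_simps)

lemma above_line_right:
  assumes "\<kappa> \<le> K t" "t < u"
  shows "Y t - \<kappa> * X t - c < Y u - \<kappa> * X u - c"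
proof (rule less_of_deriv_pos[OF assms(2) line_minus_curve_deriv])
  fix z assume "t < z"
  then show "X' z * (K z - \<kappa>) > 0"
    using K_less[of t z] assms(1) X'_pos[of z] by simp
qed

lemma above_line_left:
  assumes "K t \<le> \<kappa>" "u < t"
  shows "Y t - \<kappa> * X t - c < Y u - \<kappa> * X u - c"
proof -
  have "- (Y u - \<kappa> * X u - c) < - (Y t - \<kappa> * X t - c)"
  proof (rule less_of_deriv_pos[OF assms(2) DERIV_minus[OF line_minus_curve_deriv]])
    fix z assume "z < t"
    then show "- (X' z * (K z - \<kappa>)) > 0"
      using K_less[of z t] assms(1) X'_pos[of z] by (simp add: mult_less_0_iff)
  qed
  then show ?thesis by simp
qed

lemma height_curve_pos:
  assumes "u \<noteq> s"
  shows "height s (X u, Y u) > 0"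
  using assms above_line_right[of "K s" s u 0] above_line_left[of s "K s" u 0]
  unfolding height_def by (cases "s < u") (auto simp: algebra_simps)

lemma height_curve_self: "height s (X s, Y s) = 0"
  by (simp add: height_def)

lemma height_deriv:
  "((\<lambda>s. height s p) has_real_derivative - (K' s * (fst p - X s))) (at s)"
  unfolding height_def
  by (auto intro!: derivative_eq_intros X_deriv Y_deriv K_deriv simp: algebra_simps)

lemma height_decreasing:
  assumes "s < s'" "X s' \<le> fst p"
  shows "height s' p < height s p"
proof -
  have "- height s p < - height s' p"
  proof (rule less_of_deriv_pos[OF assms(1) DERIV_minus[OF height_deriv]])
    fix z assume "z < s'"
    then show "- (- (K' z * (fst p - X z))) > 0"
      using X_less_iff[of z s'] assms(2) K'_pos[of z] by simp
  qed
  then show ?thesis by simp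
qed

lemma height_increasing:
  assumes "s < s'" "fst p \<le> X s"
  shows "height s p < height s' p"
proof (rule less_of_deriv_pos[OF assms(1) height_deriv])
  fix z assume "s < z"
  then show "- (K' z * (fst p - X z)) > 0"
    using X_less_iff[of s z] assms(2) K'_pos[of z] by (simp add: mult_less_0_iff)
qed

text \<open>
  As a function of the parameter, the height of a fixed point decreases strictly up to the abscissa of
  the point and increases strictly after it, so each side carries at most one tangent.
\<close>

lemma two_tangents_separated:
  assumes "height s p = 0" "height s' p = 0" "s < s'"
  shows "X s < fst p" "fst p < X s'"
  using height_decreasing[OF assms(3), of p] height_increasing[OF assms(3), of p] assms(1,2)
  by (simp_all add: not_le[symmetric]) fastforce+

text \<open>
  The difference between the curve and a line is strictly monotone on either side of the parameter
  where the slopes agree. Two zeros, together with a negative value at \<open>u0\<close>, therefore have to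
  enclose \<open>u0\<close>, and they determine all the signs.
\<close>

lemma line_crosses_twice:
  fixes \<kappa> c :: real
  defines "h \<equiv> \<lambda>u. Y u - \<kappa> * X u - c"
  assumes two: "card {u. h u = 0} = 2" and u0: "h u0 < 0"
  obtains t1 t2 where "t1 < u0" "u0 < t2" "{u. h u = 0} = {t1, t2}"
    "K t1 < \<kappa>" "\<kappa> < K t2"
    "\<And>u. t1 < u \<Longrightarrow> u < t2 \<Longrightarrow> h u < 0"
    "\<And>u. u < t1 \<Longrightarrow> h u > 0" "\<And>u. u > t2 \<Longrightarrow> h u > 0"
proof -
  have right: "h t < h u" if "\<kappa> \<le> K t" "t < u" for t u
    using above_line_right[OF that] by (simp add: h_def)
  have left: "h t < h u" if "K t \<le> \<kappa>" "u < t" for t u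
    using above_line_left[OF that] by (simp add: h_def)
  obtain p q where pq: "{u. h u = 0} = {p, q}" "p < q"
    using two unfolding card_2_iff by (metis insert_commute linorder_neqE_linordered_idom)
  then have z: "h p = 0" "h q = 0" by auto
  have Kright: "\<kappa> < K t" if "u0 < t" "h t = 0" for t
    using left[of t u0] that u0 by fastforce
  have Kleft: "K t < \<kappa>" if "t < u0" "h t = 0" for t
    using right[of t u0] that u0 by fastforce
  have "p < u0"
    using Kright[of p] right[of p q] z pq(2) u0 by (metis less_imp_le less_irrefl linorder_neqE_linordered_idom)
  moreover have "u0 < q"
    using Kleft[of q] left[of q p] z pq(2) u0 by (metis less_imp_le less_irrefl linorder_neqE_linordered_idom)
  moreover have "h u < 0" if "p < u" "u < q" for u
  proof (cases "\<kappa> \<le> K u")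
    case True then show ?thesis using right[of u q] that z by simp
  next
    case False then show ?thesis using left[of u p] that z by simp
  qed
  ultimately show ?thesis
    using that[of p q] pq Kright[of q] Kleft[of p] z left[of p] right[of q] by auto
qed

lemma convex_above_tangent: "convex {p. height s p \<ge> 0}"
proof (rule convexI)
  fix p q and u v :: real
  assume h: "p \<in> {p. height s p \<ge> 0}" "q \<in> {p. height s p \<ge> 0}" "0 \<le> u" "0 \<le> v" "u + v = 1"
  then have u: "u = 1 - v" by simp
  show "u *\<^sub>R p + v *\<^sub>R q \<in> {p. height s p \<ge> 0}"
    unfolding u mem_Collect_eq height_affine using h u by simp
qed

lemma height_has_integral:
  assumes "(\<phi> has_integral (d - c) *\<^sub>R m) {c..d}" "c \<le> d"
  shows "((\<lambda>z. height s (\<phi> z)) has_integral (d - c) * height s m) {c..d}"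
proof -
  have f: "((\<lambda>z. fst (\<phi> z)) has_integral (d - c) * fst m) {c..d}"
    and g: "((\<lambda>z. snd (\<phi> z)) has_integral (d - c) * snd m) {c..d}"
    using has_integral_linear[OF assms(1) bounded_linear_fst]
      has_integral_linear[OF assms(1) bounded_linear_snd] by (simp_all add: o_def)
  have k: "((\<lambda>z. K s * X s - Y s) has_integral (d - c) * (K s * X s - Y s)) {c..d}"
    using has_integral_const_real[of "K s * X s - Y s" c d] assms(2) by simp
  from has_integral_add[OF has_integral_diff[OF g has_integral_mult_right[OF f, of "K s"]] k]
  show ?thesis by (simp add: height_def algebra_simps)
qed

lemma height_average_nonneg:
  assumes "(\<phi> has_integral (d - c) *\<^sub>R m) {c..d}" "c < d"
    and "\<And>z. c \<le> z \<Longrightarrow> z \<le> d \<Longrightarrow> height s (\<phi> z) \<ge> 0"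
  shows "height s m \<ge> 0"
  using has_integral_nonneg[OF height_has_integral[OF assms(1)]] assms
  by (simp add: zero_le_mult_iff)

lemma height_average_nonpos:
  assumes "(\<phi> has_integral (d - c) *\<^sub>R m) {c..d}" "c < d"
    and "\<And>z. c \<le> z \<Longrightarrow> z \<le> d \<Longrightarrow> height s (\<phi> z) \<le> 0"
  shows "height s m \<le> 0"
  using has_integral_nonneg[OF has_integral_neg[OF height_has_integral[OF assms(1)]]] assms
  by (simp add: mult_le_0_iff)

end

section \<open>Tangents between the two boundaries\<close>

text \<open>
  Lets all statements about tangent lines be read as equations for heights; the slope form is
  available because the first component of the velocity does not vanish.
\<close>

lemma tangent_line_iff:
  assumes "G s e = (x1 G e s, x2 G e s)"
    and "((\<lambda>u. G u e) has_vector_derivative (X', K * X')) (at s)" and "X' \<noteq> 0"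
  shows "p \<in> tangent_line G e s \<longleftrightarrow> snd p - x2 G e s - K * (fst p - x1 G e s) = 0"
proof -
  have v: "vector_derivative (\<lambda>u. G u e) (at s) = (X', K * X')"
    using assms(2) by (rule vector_derivative_at)
  show ?thesis
  proof
    assume "p \<in> tangent_line G e s"
    then show "snd p - x2 G e s - K * (fst p - x1 G e s) = 0"
      unfolding tangent_line_def v using assms(1) by auto
  next
    assume h: "snd p - x2 G e s - K * (fst p - x1 G e s) = 0"
    have "p = G s e + ((fst p - x1 G e s) / X') *\<^sub>R (X', K * X')"
      using h assms(1,3) by (simp add: prod_eq_iff mult.commute)
    then show "p \<in> tangent_line G e s"
      unfolding tangent_line_def v by blast
  qed
qed

definition tangent_slope :: "curves \<Rightarrow> real \<Rightarrow> real \<Rightarrow> real" where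
  "tangent_slope G e s = deriv (x2 G e) s / deriv (x1 G e) s"

locale domain_at = domain_family +
  fixes e :: real
  assumes e_pos: "0 < e" and e_less: "ereal e < emax"
begin

lemma e_in: "e \<in> params emax" and zero_in: "0 \<in> params emax"
  using e_pos e_less emax_pos by (auto simp: params_def zero_ereal_def)

lemma curve_deriv_data:
  assumes "d \<in> params emax"
  shows "\<exists>X'' Y''. continuous_on UNIV X'' \<and> continuous_on UNIV Y'' \<and>
    (\<forall>t. (x1 G d has_real_derivative deriv (x1 G d) t) (at t) \<and>
         (x2 G d has_real_derivative deriv (x2 G d) t) (at t) \<and>
         (deriv (x1 G d) has_real_derivative X'' t) (at t) \<and>
         (deriv (x2 G d) has_real_derivative Y'' t) (at t))"
proof -
  obtain D :: "nat \<Rightarrow> nat \<Rightarrow> real \<Rightarrow> real \<Rightarrow> real \<times> real" where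
    D: "\<forall>t. \<forall>e\<in>params emax. D 0 0 t e = G t e"
      "\<forall>i<3. \<forall>j\<le>1. \<forall>t. \<forall>e\<in>params emax.
         ((\<lambda>s. D i j s e) has_vector_derivative D (Suc i) j t e) (at t)"
      "\<forall>i\<le>3. \<forall>j\<le>1. continuous_on (UNIV \<times> params emax) (\<lambda>(t, e). D i j t e)"
    using smooth unfolding C31_smooth_def by blast
  have D0: "D 0 0 t d = G t d" for t
    using D(1) assms by blast
  have D1: "((\<lambda>s. D i 0 s d) has_vector_derivative D (Suc i) 0 t d) (at t)" if "i < 3" for i t
    using D(2) assms that by simp
  have Dc: "continuous_on (UNIV \<times> params emax) (\<lambda>(t, e). D i 0 t e)" if "i \<le> 3" for i
    using D(3) that by simp
  have F: "((\<lambda>s. fst (D i 0 s d)) has_real_derivative fst (D (Suc i) 0 t d)) (at t)"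
    and S: "((\<lambda>s. snd (D i 0 s d)) has_real_derivative snd (D (Suc i) 0 t d)) (at t)" if "i < 3" for i t
    using has_derivative_fst[OF D1[OF that, of t, unfolded has_vector_derivative_def]]
      has_derivative_snd[OF D1[OF that, of t, unfolded has_vector_derivative_def]]
    by (simp_all add: has_vector_derivative_def has_real_derivative_iff_has_vector_derivative)
  have c: "continuous_on UNIV (\<lambda>t. D 2 0 t d)"
  proof -
    have "continuous_on UNIV ((\<lambda>(t, e). D 2 0 t e) \<circ> (\<lambda>t. (t, d)))"
      by (intro continuous_on_compose continuous_on_subset[OF Dc] continuous_intros)
        (use assms in auto)
    then show ?thesis by (simp add: o_def)
  qed
  have e1: "x1 G d = (\<lambda>s. fst (D 0 0 s d))" "x2 G d = (\<lambda>s. snd (D 0 0 s d))"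
    by (auto simp: x1_def x2_def D0)
  have d1: "deriv (x1 G d) = (\<lambda>s. fst (D 1 0 s d))" "deriv (x2 G d) = (\<lambda>s. snd (D 1 0 s d))"
    unfolding e1 using F[of 0] S[of 0] by (auto intro!: ext DERIV_imp_deriv)
  show ?thesis
    apply (rule exI[of _ "\<lambda>t. fst (D 2 0 t d)"], rule exI[of _ "\<lambda>t. snd (D 2 0 t d)"])
    unfolding d1 unfolding e1
    using F[of 0] S[of 0] F[of 1] S[of 1] c
    by (auto intro!: continuous_intros simp: numeral_2_eq_2)
qed

lemma curve_convex:
  assumes "d \<in> params emax"
  shows "convex_curve (x1 G d) (x2 G d) (deriv (x1 G d)) (tangent_slope G d)
    (deriv (tangent_slope G d))"
proof -
  obtain X'' Y'' where c: "continuous_on UNIV X''" "continuous_on UNIV Y''" and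
    der: "\<And>t. (x1 G d has_real_derivative deriv (x1 G d) t) (at t)"
      "\<And>t. (x2 G d has_real_derivative deriv (x2 G d) t) (at t)"
      "\<And>t. (deriv (x1 G d) has_real_derivative X'' t) (at t)"
      "\<And>t. (deriv (x2 G d) has_real_derivative Y'' t) (at t)"
    using curve_deriv_data[OF assms] by blast
  let ?X = "deriv (x1 G d)" and ?Y = "deriv (x2 G d)"
  have pos: "?X t > 0" for t using x1_deriv_pos[OF assms] .
  have cd: "continuous_on UNIV ?X" "continuous_on UNIV ?Y"
    using der(3,4) by (meson DERIV_isCont continuous_at_imp_continuous_on)+
  define K' where "K' t = (Y'' t * ?X t - ?Y t * X'' t) / (?X t * ?X t)" for t
  have K: "(tangent_slope G d has_real_derivative K' t) (at t)" for t
    unfolding tangent_slope_def[abs_def] K'_def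
    using DERIV_divide[OF der(4) der(3), of t] pos[of t] by simp
  have K'eq: "deriv (tangent_slope G d) = K'"
    using K by (auto intro!: ext DERIV_imp_deriv)
  have "Y'' t * ?X t - ?Y t * X'' t > 0" for t
    using curvature_pos[OF assms, of t] DERIV_imp_deriv[OF der(3)] DERIV_imp_deriv[OF der(4)] by simp
  then have K'p: "K' t > 0" for t
    unfolding K'_def using pos[of t] by simp
  have "continuous_on UNIV K'"
    unfolding K'_def[abs_def] by (intro continuous_intros c cd) (metis less_irrefl pos mult_eq_0_iff)
  then show ?thesis
    unfolding K'eq
    using der(1,2) pos K K'p cd
    by unfold_locales (auto simp: tangent_slope_def less_imp_neq[THEN not_sym])
qed

sublocale lower: convex_curve "x1 G 0" "x2 G 0" "deriv (x1 G 0)" "tangent_slope G 0"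
    "deriv (tangent_slope G 0)"
  by (rule curve_convex[OF zero_in])

sublocale upper: convex_curve "x1 G e" "x2 G e" "deriv (x1 G e)" "tangent_slope G e"
    "deriv (tangent_slope G e)"
  by (rule curve_convex[OF e_in])

lemma point_eq: "G t d = (x1 G d t, x2 G d t)"
  by (simp add: x1_def x2_def)

lemma upper_vector_derivative:
  "((\<lambda>u. G u e) has_vector_derivative
     (deriv (x1 G e) s, tangent_slope G e s * deriv (x1 G e) s)) (at s)"
proof -
  have "((\<lambda>u. (x1 G e u, x2 G e u)) has_vector_derivative
     (deriv (x1 G e) s, tangent_slope G e s * deriv (x1 G e) s)) (at s)"
    using upper.X_deriv[of s] upper.Y_deriv[of s]
    by (intro has_vector_derivative_Pair) (simp_all add: has_real_derivative_iff_has_vector_derivative)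
  then show ?thesis by (simp add: point_eq[symmetric])
qed

lemma tangent_line_height: "p \<in> tangent_line G e s \<longleftrightarrow> upper.height s p = 0"
  unfolding upper.height_def
  by (rule tangent_line_iff[OF point_eq upper_vector_derivative])
    (use upper.X'_pos[of s] in simp)

lemma tangency_height: "tangency_params G e p = {s. upper.height s p = 0}"
  by (simp add: tangency_params_def tangent_line_height)

text \<open>
  The inclusion of the epigraphs gives the weak inequality, after raising the point of the upper curve a
  little; the separation of the curves excludes equality.
\<close>

lemma upper_above_lower: "\<exists>u. x1 G 0 u = x1 G e s \<and> x2 G 0 u < x2 G e s"
proof -
  have *: "\<exists>u. x1 G 0 u = x1 G e s \<and> x2 G 0 u < y" if "x2 G e s < y" for y
  proof -
    have "(x1 G e s, y) \<in> Xi G e" unfolding Xi_def using that by blast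
    then have "(x1 G e s, y) \<in> Xi G 0"
      using Xi_decreasing[OF zero_in e_in e_pos] by blast
    then show ?thesis unfolding Xi_def by force
  qed
  obtain u where u: "x1 G 0 u = x1 G e s"
    using *[of "x2 G e s + 1"] by auto
  have le: "x2 G 0 u \<le> x2 G e s"
  proof (rule dense_ge)
    fix y assume "x2 G e s < y"
    then show "x2 G 0 u \<le> y"
      using * u lower.X_eq_iff by (metis less_imp_le)
  qed
  have "G s e \<in> closure (Xi G e)"
  proof -
    have "(\<lambda>n. (x1 G e s, x2 G e s + 1 / real (Suc n))) \<longlonglongrightarrow> (x1 G e s, x2 G e s + 0)"
      by (intro tendsto_intros LIMSEQ_Suc lim_1_over_n)
    moreover have "(x1 G e s, x2 G e s + 1 / real (Suc n)) \<in> Xi G e" for n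
      unfolding Xi_def by force
    ultimately show ?thesis
      unfolding closure_sequential point_eq[of s e] add_0_right
      by (intro exI[of _ "\<lambda>n. (x1 G e s, x2 G e s + 1 / real (Suc n))"] conjI allI)
  qed
  then have "G u 0 \<noteq> G s e"
    using Xi_separated[OF zero_in e_in e_pos, of u] by metis
  then show ?thesis using u le point_eq by (metis order_le_less)
qed

lemma lower_height_upper_pos: "lower.height t (G s e) > 0"
proof -
  obtain u where u: "x1 G 0 u = x1 G e s" "x2 G 0 u < x2 G e s"
    using upper_above_lower by blast
  have "lower.height t (x1 G 0 u, x2 G 0 u) \<ge> 0"
    using lower.height_curve_pos lower.height_curve_self by (cases "u = t") (auto simp: less_imp_le)
  then show ?thesis using u by (simp add: lower.height_def point_eq)
qed

lemma upper_height_Xi: "p \<in> Xi G e \<Longrightarrow> upper.height s p > 0"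
proof -
  assume "p \<in> Xi G e"
  then obtain u y where p: "p = (x1 G e u, y)" "y > x2 G e u" unfolding Xi_def by blast
  have "upper.height s (x1 G e u, x2 G e u) \<ge> 0"
    using upper.height_curve_pos upper.height_curve_self by (cases "u = s") (auto simp: less_imp_le)
  then show ?thesis using p by (simp add: upper.height_def)
qed

lemma s_R_less_s_L: "s_R G t e < s_L G t e"
  and tangency_params_eq: "tangency_params G e (G t 0) = {s_R G t e, s_L G t e}"
proof -
  let ?S = "tangency_params G e (G t 0)"
  have c: "card ?S = 2" using two_tangents[OF e_in e_pos] .
  then have fin: "finite ?S" by (metis card.infinite zero_neq_numeral)
  obtain p q where pq: "?S = {p, q}" "p < q"
    using c unfolding card_2_iff by (metis insert_commute linorder_neqE_linordered_idom)
  then show "s_R G t e < s_L G t e" "?S = {s_R G t e, s_L G t e}"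
    unfolding s_R_def s_L_def by auto
qed

lemma height_s_R: "upper.height (s_R G t e) (G t 0) = 0"
  and height_s_L: "upper.height (s_L G t e) (G t 0) = 0"
  using tangency_params_eq[of t] tangency_height by blast+

lemma w_R_left: "x1 G e (s_R G t e) < x1 G 0 t"
  and w_L_right: "x1 G 0 t < x1 G e (s_L G t e)"
  using upper.two_tangents_separated[OF height_s_R height_s_L s_R_less_s_L, of t]
  by (auto simp: point_eq)

text \<open>
  Of the two tangents from \<open>g(t)\<close>, the right one is recognised by having its tangency point to the left
  of \<open>g(t)\<close>.
\<close>

lemma s_R_unique:
  assumes "upper.height s (G t 0) = 0" "x1 G e s \<le> x1 G 0 t"
  shows "s = s_R G t e"
proof -
  have "s \<in> {s_R G t e, s_L G t e}"
    using assms(1) tangency_params_eq[of t] tangency_height by blast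
  then show ?thesis using assms(2) w_L_right[of t] by auto
qed

lemma s_L_unique:
  assumes "upper.height s (G t 0) = 0" "x1 G 0 t \<le> x1 G e s"
  shows "s = s_L G t e"
proof -
  have "s \<in> {s_R G t e, s_L G t e}"
    using assms(1) tangency_params_eq[of t] tangency_height by blast
  then show ?thesis using assms(2) w_R_left[of t] by auto
qed

text \<open>
  A tangent to the upper curve through a point of the fixed boundary cuts off a chord that contains the
  tangency point. Seen from the right end of the chord it is the right tangent, seen from the left end the
  left tangent.
\<close>

lemma tangent_chord:
  assumes "upper.height s (G t 0) = 0"
  obtains t1 t2 where "x1 G 0 t1 < x1 G e s" "x1 G e s < x1 G 0 t2"
    "{u. upper.height s (G u 0) = 0} = {t1, t2}"
    "tangent_slope G 0 t1 < tangent_slope G e s" "tangent_slope G e s < tangent_slope G 0 t2"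
    "\<And>u. t1 < u \<Longrightarrow> u < t2 \<Longrightarrow> upper.height s (G u 0) < 0"
    "\<And>u. u < t1 \<Longrightarrow> upper.height s (G u 0) > 0" "\<And>u. u > t2 \<Longrightarrow> upper.height s (G u 0) > 0"
    "s = s_L G t1 e" "s = s_R G t2 e"
proof -
  let ?k = "tangent_slope G e s"
  let ?c = "x2 G e s - ?k * x1 G e s"
  have eq: "x2 G 0 u - ?k * x1 G 0 u - ?c = upper.height s (G u 0)" for u
    by (simp add: upper.height_def point_eq algebra_simps)
  obtain u0 where u0: "x1 G 0 u0 = x1 G e s" "x2 G 0 u0 < x2 G e s"
    using upper_above_lower by blast
  have "card {u. upper.height s (G u 0) = 0} = 2"
    using tangents_meet_twice[OF e_in e_pos, of s t] assms
    by (simp add: tangency_height tangent_line_height)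
  moreover have "upper.height s (G u0 0) < 0"
    using u0 by (simp add: upper.height_def point_eq)
  ultimately obtain t1 t2 where t: "t1 < u0" "u0 < t2" "{u. upper.height s (G u 0) = 0} = {t1, t2}"
    "tangent_slope G 0 t1 < ?k" "?k < tangent_slope G 0 t2"
    "\<And>u. t1 < u \<Longrightarrow> u < t2 \<Longrightarrow> upper.height s (G u 0) < 0"
    "\<And>u. u < t1 \<Longrightarrow> upper.height s (G u 0) > 0" "\<And>u. u > t2 \<Longrightarrow> upper.height s (G u 0) > 0"
    using lower.line_crosses_twice[of ?k ?c u0, unfolded eq] by blast
  have x: "x1 G 0 t1 < x1 G e s" "x1 G e s < x1 G 0 t2"
    using t(1,2) u0(1) lower.X_less_iff by metis+
  have "upper.height s (G t1 0) = 0" "upper.height s (G t2 0) = 0"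
    using t(3) by blast+
  then have "s = s_L G t1 e" "s = s_R G t2 e"
    using s_L_unique s_R_unique x by (simp_all add: less_imp_le)
  then show ?thesis using that[OF x t(3-8)] by blast
qed

lemma right_chord:
  obtains t1 where "t1 < t" "x1 G 0 t1 < x1 G e (s_R G t e)"
    "upper.height (s_R G t e) (G t1 0) = 0"
    "tangent_slope G 0 t1 < tangent_slope G e (s_R G t e)"
    "tangent_slope G e (s_R G t e) < tangent_slope G 0 t"
    "\<And>u. t1 < u \<Longrightarrow> u < t \<Longrightarrow> upper.height (s_R G t e) (G u 0) < 0"
    "\<And>u. u < t1 \<Longrightarrow> upper.height (s_R G t e) (G u 0) > 0"
    "\<And>u. u > t \<Longrightarrow> upper.height (s_R G t e) (G u 0) > 0"
    "s_R G t e = s_L G t1 e"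
proof -
  let ?s = "s_R G t e"
  obtain t1 t2 where c: "x1 G 0 t1 < x1 G e ?s" "x1 G e ?s < x1 G 0 t2"
    "{u. upper.height ?s (G u 0) = 0} = {t1, t2}"
    "tangent_slope G 0 t1 < tangent_slope G e ?s" "tangent_slope G e ?s < tangent_slope G 0 t2"
    "\<And>u. t1 < u \<Longrightarrow> u < t2 \<Longrightarrow> upper.height ?s (G u 0) < 0"
    "\<And>u. u < t1 \<Longrightarrow> upper.height ?s (G u 0) > 0" "\<And>u. u > t2 \<Longrightarrow> upper.height ?s (G u 0) > 0"
    "?s = s_L G t1 e"
    by (rule tangent_chord[OF height_s_R[of t]]) blast
  have "t = t2" using c(1,3) height_s_R[of t] w_R_left[of t] by force
  moreover have "t1 < t" using c(1) w_R_left[of t] lower.X_less_iff by (metis order.strict_trans)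
  ultimately show ?thesis using that c by blast
qed

section \<open>Motion of the right tangency point\<close>

lemma height_eq: "upper.height s (G t 0) =
    x2 G 0 t - x2 G e s - tangent_slope G e s * (x1 G 0 t - x1 G e s)"
  by (simp add: upper.height_def point_eq)

text \<open>
  The height of \<open>g(t)\<close> changes sign strictly at \<open>s_R G t e\<close>. The two signs persist for nearby
  parameters, which traps a tangency parameter, and it belongs to the right tangent by
  \<open>s_R_unique\<close>.
\<close>

lemma s_R_cont: "continuous_on A (\<lambda>t. s_R G t e)"
proof (intro continuous_at_imp_continuous_on ballI)
  fix t
  let ?s = "s_R G t e"
  show "isCont (\<lambda>t. s_R G t e) t"
    unfolding continuous_at tendsto_iff
  proof (intro allI impI)
    fix \<eta> :: real assume \<eta>: "\<eta> > 0"
    have "eventually (\<lambda>z. x1 G e z < x1 G 0 t) (at ?s)"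
      using upper.X_deriv[of ?s, THEN DERIV_isCont] w_R_left[of t]
      unfolding isCont_def by (intro order_tendstoD(2))
    then obtain d where d: "d > 0" "\<And>z. z \<noteq> ?s \<Longrightarrow> dist z ?s < d \<Longrightarrow> x1 G e z < x1 G 0 t"
      unfolding eventually_at by blast
    define \<delta> where "\<delta> = min \<eta> d / 2"
    have \<delta>: "0 < \<delta>" "\<delta> < \<eta>" "\<delta> < d" using \<eta> d(1) by (auto simp: \<delta>_def)
    have X2: "x1 G e (?s + \<delta>) < x1 G 0 t"
      using d(2)[of "?s + \<delta>"] \<delta> by (simp add: dist_real_def)
    have h1: "upper.height (?s - \<delta>) (G t 0) > 0"
      using upper.height_decreasing[of "?s - \<delta>" ?s "G t 0"] height_s_R[of t] \<delta> w_R_left[of t]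
      by (simp add: point_eq)
    have h2: "upper.height (?s + \<delta>) (G t 0) < 0"
      using upper.height_decreasing[of ?s "?s + \<delta>" "G t 0"] height_s_R[of t] \<delta> X2
      by (simp add: point_eq)
    have xc: "isCont (x1 G 0) t" and yc: "isCont (x2 G 0) t"
      using lower.X_deriv lower.Y_deriv by (blast intro: DERIV_isCont)+
    have hc: "isCont (\<lambda>u. upper.height z (G u 0)) t" for z
      unfolding height_eq by (intro continuous_intros xc yc)
    have "eventually (\<lambda>u. upper.height (?s - \<delta>) (G u 0) > 0) (at t)"
      using hc h1 unfolding isCont_def by (intro order_tendstoD(1))
    moreover have "eventually (\<lambda>u. upper.height (?s + \<delta>) (G u 0) < 0) (at t)"
      using hc h2 unfolding isCont_def by (intro order_tendstoD(2))
    moreover have "eventually (\<lambda>u. x1 G e (?s + \<delta>) < x1 G 0 u) (at t)"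
      using xc X2 unfolding isCont_def by (intro order_tendstoD(1))
    ultimately show "eventually (\<lambda>u. dist (s_R G u e) ?s < \<eta>) (at t)"
    proof eventually_elim
      case (elim u)
      obtain z where z: "?s - \<delta> \<le> z" "z \<le> ?s + \<delta>" "upper.height z (G u 0) = 0"
        using IVT2'[of "\<lambda>z. upper.height z (G u 0)" "?s + \<delta>" 0 "?s - \<delta>"] elim(1,2) \<delta>(1)
          upper.height_cont by (auto simp: less_imp_le)
      have "x1 G e z \<le> x1 G 0 u"
        using z(2) elim(3) upper.X_le_iff by (meson less_imp_le order_trans)
      then have "z = s_R G u e" using s_R_unique z(3) by blast
      then show ?case using z(1,2) \<delta> by (auto simp: dist_real_def)
    qed
  qed
qed

text \<open>
  The derivative of the implicit function \<open>s_R\<close>: minus the \<open>t\<close>-derivative of the height of \<open>g(t)\<close> above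
  the tangent at \<open>s\<close>, divided by its \<open>s\<close>-derivative.
\<close>

definition s_R_velocity :: "real \<Rightarrow> real" where
  "s_R_velocity t = deriv (x1 G 0) t * (tangent_slope G 0 t - tangent_slope G e (s_R G t e)) /
     (deriv (tangent_slope G e) (s_R G t e) * (x1 G 0 t - x1 G e (s_R G t e)))"

text \<open>
  The implicit function theorem by hand: with \<open>q\<close> the difference quotient of the height in \<open>s\<close>, the equation
  for the tangent at the time \<open>u\<close> expresses \<open>q (s(u)) (s(u) - s(t))\<close> by increments of \<open>g\<close> alone, and
  continuity of \<open>s_R\<close> lets \<open>q (s(u))\<close> converge to a nonzero number.
\<close>

lemma s_R_deriv: "((\<lambda>t. s_R G t e) has_real_derivative s_R_velocity t) (at t)"
proof -
  let ?s = "\<lambda>t. s_R G t e" and ?K = "tangent_slope G e"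
  let ?A = "deriv (tangent_slope G e) (?s t) * (x1 G 0 t - x1 G e (?s t))"
  have A: "?A > 0" using upper.K'_pos[of "?s t"] w_R_left[of t] by simp
  have "((\<lambda>z. upper.height z (G t 0)) has_real_derivative - ?A) (at (?s t))"
    using upper.height_deriv[of "G t 0" "?s t"] by (simp add: point_eq)
  then obtain q where q: "\<And>z. upper.height z (G t 0) - upper.height (?s t) (G t 0) = q z * (z - ?s t)"
    "isCont q (?s t)" "q (?s t) = - ?A"
    unfolding CARAT_DERIV by blast
  have lim: "(?s \<longlongrightarrow> ?s t) (at t)"
    using s_R_cont[of UNIV] by (simp add: continuous_on_eq_continuous_at isCont_def)
  have ql: "((\<lambda>u. q (?s u)) \<longlongrightarrow> - ?A) (at t)"
    using isCont_tendsto_compose[OF q(2) lim] q(3) by simp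
  have Kl: "((\<lambda>u. ?K (?s u)) \<longlongrightarrow> ?K (?s t)) (at t)"
    using isCont_tendsto_compose[OF DERIV_isCont[OF upper.K_deriv] lim] .
  let ?gx = "\<lambda>u. (x1 G 0 u - x1 G 0 t) / (u - t)" and ?gy = "\<lambda>u. (x2 G 0 u - x2 G 0 t) / (u - t)"
  have gx: "(?gx \<longlongrightarrow> deriv (x1 G 0) t) (at t)"
    and gy: "(?gy \<longlongrightarrow> tangent_slope G 0 t * deriv (x1 G 0) t) (at t)"
    using lower.X_deriv lower.Y_deriv unfolding has_field_derivative_iff by blast+
  have "((\<lambda>u. - (?gy u - ?K (?s u) * ?gx u) / q (?s u)) \<longlongrightarrow>
      - (tangent_slope G 0 t * deriv (x1 G 0) t - ?K (?s t) * deriv (x1 G 0) t) / - ?A) (at t)"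
    by (intro tendsto_intros gx gy Kl ql) (use A in auto)
  also have "- (tangent_slope G 0 t * deriv (x1 G 0) t - ?K (?s t) * deriv (x1 G 0) t) / - ?A
      = s_R_velocity t"
    unfolding s_R_velocity_def minus_divide_left[symmetric] minus_divide_right[symmetric] minus_minus
    by (simp add: right_diff_distrib' mult.commute)
  finally have lim_quotient: "((\<lambda>u. - (?gy u - ?K (?s u) * ?gx u) / q (?s u)) \<longlongrightarrow> s_R_velocity t) (at t)" .
  have "eventually (\<lambda>u. - (?gy u - ?K (?s u) * ?gx u) / q (?s u) = (?s u - ?s t) / (u - t)) (at t)"
  proof -
    have "eventually (\<lambda>u. q (?s u) < 0) (at t)"
      using ql A by (intro order_tendstoD(2)) auto
    moreover have "eventually (\<lambda>u. u \<noteq> t) (at t)"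
      by (simp add: eventually_at_filter)
    ultimately show ?thesis
    proof eventually_elim
      case (elim u)
      have "q (?s u) * (?s u - ?s t) = upper.height (?s u) (G t 0) - upper.height (?s u) (G u 0)"
        using q(1)[of "?s u"] height_s_R by simp
      also have "\<dots> = - ((x2 G 0 u - x2 G 0 t) - ?K (?s u) * (x1 G 0 u - x1 G 0 t))"
        unfolding height_eq by (simp add: algebra_simps)
      also have "\<dots> = - (?gy u - ?K (?s u) * ?gx u) * (u - t)"
      proof -
        have g: "?gy u * (u - t) = x2 G 0 u - x2 G 0 t" "?gx u * (u - t) = x1 G 0 u - x1 G 0 t"
          using elim(2) by simp_all
        have alg: "- (p - k * r) * w = - (p * w - k * (r * w))" for p k r w :: real
          by (simp add: algebra_simps)
        show ?thesis unfolding alg g ..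
      qed
      finally show ?case using elim by (simp add: frac_eq_eq mult.commute)
    qed
  qed
  then show ?thesis
    unfolding has_field_derivative_iff by (rule Lim_transform_eventually[OF lim_quotient])
qed

lemma segment_direction: "G t 0 - w_R G t e =
    (x1 G 0 t - x1 G e (s_R G t e)) *\<^sub>R (1, tangent_slope G e (s_R G t e))"
  using height_s_R[of t] unfolding height_eq by (simp add: w_R_def point_eq)

text \<open>
  Both \<open>w_R'\<close> and \<open>g - w_R\<close> are multiples of the tangent vector of the upper curve, and
  \<open>g - w_R\<close> does not vanish; so the number defining \<open>lambda_R\<close> exists and is unique.
\<close>

lemma w_R_deriv_and_lambda_R:
  shows w_R_deriv: "((\<lambda>t. w_R G t e) has_vector_derivative lambda_R G e t *\<^sub>R (G t 0 - w_R G t e)) (at t)"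
    and lambda_R_eq: "lambda_R G e t = deriv (x1 G e) (s_R G t e) * s_R_velocity t /
      (x1 G 0 t - x1 G e (s_R G t e))"
proof -
  let ?s = "s_R G t e"
  let ?l = "deriv (x1 G e) ?s * s_R_velocity t / (x1 G 0 t - x1 G e ?s)"
  have d: "x1 G 0 t - x1 G e ?s > 0" using w_R_left[of t] by simp
  have "((\<lambda>u. G u e) \<circ> (\<lambda>t. s_R G t e) has_vector_derivative
      s_R_velocity t *\<^sub>R (deriv (x1 G e) ?s, tangent_slope G e ?s * deriv (x1 G e) ?s)) (at t)"
    by (rule vector_diff_chain_at[OF _ upper_vector_derivative])
      (use s_R_deriv in \<open>simp add: has_real_derivative_iff_has_vector_derivative\<close>)
  moreover have "s_R_velocity t *\<^sub>R (deriv (x1 G e) ?s, tangent_slope G e ?s * deriv (x1 G e) ?s)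
      = ?l *\<^sub>R (G t 0 - w_R G t e)"
    unfolding segment_direction using d by simp
  ultimately have w: "((\<lambda>t. w_R G t e) has_vector_derivative ?l *\<^sub>R (G t 0 - w_R G t e)) (at t)"
    by (simp add: o_def w_R_def)
  have ne: "G t 0 - w_R G t e \<noteq> 0"
    unfolding segment_direction using d by (simp add: zero_prod_def)
  show l: "lambda_R G e t = ?l"
    unfolding lambda_R_def vector_derivative_at[OF w]
  proof (rule the_equality)
    fix l assume "l *\<^sub>R (G t 0 - w_R G t e) = ?l *\<^sub>R (G t 0 - w_R G t e)"
    then show "l = ?l" using ne by (metis scaleR_cancel_right)
  qed simp
  show "((\<lambda>t. w_R G t e) has_vector_derivative lambda_R G e t *\<^sub>R (G t 0 - w_R G t e)) (at t)"
    unfolding l by (rule w)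
qed

lemma s_R_velocity_pos: "s_R_velocity t > 0"
proof -
  have "tangent_slope G e (s_R G t e) < tangent_slope G 0 t"
    by (rule right_chord[of t])
  then show ?thesis
    unfolding s_R_velocity_def using lower.X'_pos[of t] upper.K'_pos w_R_left[of t] by simp
qed

lemma lambda_R_pos: "lambda_R G e t > 0"
  unfolding lambda_R_eq using s_R_velocity_pos[of t] upper.X'_pos w_R_left[of t] by simp

lemma continuous_along_s_R: "continuous_on UNIV h \<Longrightarrow> continuous_on A (\<lambda>t. h (s_R G t e))"
  for h :: "real \<Rightarrow> real"
  by (rule continuous_on_compose2[OF _ s_R_cont]) auto

lemma lambda_R_cont: "continuous_on A (\<lambda>t. lambda_R G e t)"
proof -
  have x: "x1 G 0 t \<noteq> x1 G e (s_R G t e)" "deriv (tangent_slope G e) (s_R G t e) \<noteq> 0" for t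
    using w_R_left[of t] upper.K'_pos[of "s_R G t e"] by simp_all
  have "continuous_on UNIV (\<lambda>t. lambda_R G e t)"
    unfolding lambda_R_eq s_R_velocity_def
    by (intro continuous_intros lower.X_cont lower.K_cont lower.X'_cont continuous_along_s_R
        upper.X_cont upper.K_cont upper.X'_cont upper.K'_cont) (use x in auto)
  then show ?thesis using continuous_on_subset by blast
qed

section \<open>Points of the domain\<close>

lemma lower_height_nonneg: "lower.height t (G u 0) \<ge> 0"
  using lower.height_curve_pos[of u t] lower.height_curve_self[of t]
  by (cases "u = t") (auto simp: point_eq less_imp_le)

lemma upper_height_nonneg: "upper.height s (G u e) \<ge> 0"
  using upper.height_curve_pos[of u s] upper.height_curve_self[of s]
  by (cases "u = s") (auto simp: point_eq less_imp_le)

lemma height_on_tangent: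
  assumes "upper.height s p = 0" "upper.height s q = 0"
    "fst p \<le> fst x" "fst x \<le> fst q" "fst p < fst q" "upper.height s x = 0"
  shows "x \<in> convex hull {p, q}"
proof -
  define r where "r = (fst x - fst p) / (fst q - fst p)"
  have r: "0 \<le> r" "r \<le> 1" "r * (fst q - fst p) = fst x - fst p"
    using assms(3-5) by (auto simp: r_def)
  have "x = (1 - r) *\<^sub>R p + r *\<^sub>R q"
  proof (rule prod_eqI)
    show f: "fst x = fst ((1 - r) *\<^sub>R p + r *\<^sub>R q)"
      using r(3) by (simp add: algebra_simps)
    have "upper.height s ((1 - r) *\<^sub>R p + r *\<^sub>R q) = 0"
      unfolding upper.height_affine using assms(1,2) by simp
    then have "snd ((1 - r) *\<^sub>R p + r *\<^sub>R q) =
       x2 G e s + tangent_slope G e s * (fst ((1 - r) *\<^sub>R p + r *\<^sub>R q) - x1 G e s)"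
      unfolding upper.height_def by linarith
    then show "snd x = snd ((1 - r) *\<^sub>R p + r *\<^sub>R q)"
      using assms(6) unfolding f[symmetric] upper.height_def by linarith
  qed
  then show ?thesis
    unfolding segment_convex_hull[symmetric] closed_segment_def using r by blast
qed

lemma triangle_in_Omega:
  assumes "x \<in> convex hull {G t 0, w_L G t e, w_R G t e}" "upper.height s x = 0"
  shows "x \<in> Omega G e"
proof -
  have "x \<notin> Xi G e" using upper_height_Xi[of x s] assms(2) by auto
  then show ?thesis using assms(1) unfolding Omega_def curvilinear_triangle_def by blast
qed

lemma height_w_R: "upper.height (s_R G t e) (w_R G t e) = 0"
  using upper.height_curve_self by (simp add: w_R_def point_eq)

lemma fst_curve: "fst (G t d) = x1 G d t" "fst (w_R G t e) = x1 G e (s_R G t e)"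
    "fst (w_L G t e) = x1 G e (s_L G t e)"
  by (simp_all add: w_R_def w_L_def x1_def)

lemma snd_curve: "snd (G t d) = x2 G d t" "snd (w_R G t e) = x2 G e (s_R G t e)"
    "snd (w_L G t e) = x2 G e (s_L G t e)"
  by (simp_all add: w_R_def w_L_def x2_def)

text \<open>
  The first hypothesis says that \<open>x\<close> lies above the fixed boundary, which is the envelope of its tangents.
  On the right tangent from \<open>g(t)\<close> this confines \<open>x\<close> to the chord between the two points of the fixed
  boundary, because the tangents to the fixed boundary at these points have slopes on either side of the slope
  of the chord. One half of the chord is a right tangent segment, the other half a left one.
\<close>

lemma chord_in_Omega:
  assumes above: "\<And>u. lower.height u x \<ge> 0" and on: "upper.height (s_R G t e) x = 0"
  shows "x \<in> Omega G e"
proof -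
  let ?s = "s_R G t e"
  obtain t1 where t1: "t1 < t" "x1 G 0 t1 < x1 G e ?s" "upper.height ?s (G t1 0) = 0"
    "tangent_slope G 0 t1 < tangent_slope G e ?s" "tangent_slope G e ?s < tangent_slope G 0 t"
    "?s = s_L G t1 e"
    by (rule right_chord[of t])
  have slope_diff: "(tangent_slope G e ?s - tangent_slope G 0 u) * (fst x - x1 G 0 u) \<ge> 0"
    if "upper.height ?s (G u 0) = 0" for u
    using above[of u] that on unfolding lower.height_def upper.height_def fst_curve snd_curve
    by (simp add: algebra_simps)
  have "fst x \<le> x1 G 0 t"
    using slope_diff[OF height_s_R] t1(5) by (simp add: zero_le_mult_iff)
  moreover have "x1 G 0 t1 \<le> fst x"
    using slope_diff[OF t1(3)] t1(4) by (simp add: zero_le_mult_iff)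
  moreover have "w_L G t1 e = w_R G t e"
    using t1(6) by (simp add: w_L_def w_R_def)
  ultimately show ?thesis
  proof (cases "fst x \<le> x1 G e ?s")
    case True
    have "x \<in> convex hull {G t1 0, w_L G t1 e}"
      by (rule height_on_tangent[OF t1(3) _ _ _ _ on])
        (use t1 height_w_R[of t] True \<open>x1 G 0 t1 \<le> fst x\<close> \<open>w_L G t1 e = w_R G t e\<close> in \<open>auto simp: fst_curve\<close>)
    then show ?thesis
      by (intro triangle_in_Omega[OF _ on, of t1]) (erule rev_subsetD, rule hull_mono, blast)
  next
    case False
    have "x \<in> convex hull {w_R G t e, G t 0}"
      by (rule height_on_tangent[OF height_w_R height_s_R _ _ _ on])
        (use False w_R_left[of t] \<open>fst x \<le> x1 G 0 t\<close> in \<open>auto simp: fst_curve\<close>)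
    then show ?thesis
      by (intro triangle_in_Omega[OF _ on, of t]) (erule rev_subsetD, rule hull_mono, blast)
  qed
qed

lemma Omega_above_lower: "x \<in> Omega G e \<Longrightarrow> lower.height u x \<ge> 0"
proof -
  assume "x \<in> Omega G e"
  then obtain t where "x \<in> convex hull {G t 0, w_L G t e, w_R G t e}"
    unfolding Omega_def curvilinear_triangle_def by blast
  moreover have "convex hull {G t 0, w_L G t e, w_R G t e} \<subseteq> {p. lower.height u p \<ge> 0}"
    using lower_height_nonneg lower_height_upper_pos
    by (intro hull_minimal lower.convex_above_tangent) (auto simp: w_L_def w_R_def less_imp_le)
  ultimately show ?thesis by blast
qed

text \<open>
  Starting from a triangle containing \<open>x\<close>, a tangent to the upper curve through \<open>x\<close>, with tangency point not
  to the right of \<open>x\<close>, is found by the intermediate value theorem. Continued to the right, it meets the fixed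
  boundary no later than at the point \<open>g(t1)\<close> where the side of the triangle through \<open>w_L G t0 e\<close>, prolonged
  beyond that point, meets it again; seen from the meeting point it is the right tangent.
\<close>

lemma right_tangents_cover:
  assumes x: "x \<in> Omega G e - fixed_boundary G"
  obtains t r where "0 < r" "r \<le> 1" "x = (1 - r) *\<^sub>R G t 0 + r *\<^sub>R w_R G t e"
proof -
  obtain t0 where hull: "x \<in> convex hull {G t0 0, w_L G t0 e, w_R G t0 e}" and nXi: "x \<notin> Xi G e"
    using x unfolding Omega_def curvilinear_triangle_def by blast
  let ?sR = "s_R G t0 e" and ?sL = "s_L G t0 e"
  have fstx: "x1 G e ?sR \<le> fst x" "fst x \<le> x1 G e ?sL"
  proof -
    have "convex hull {G t0 0, w_L G t0 e, w_R G t0 e} \<subseteq> {x1 G e ?sR .. x1 G e ?sL} \<times> UNIV"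
      using w_R_left[of t0] w_L_right[of t0] s_R_less_s_L[of t0]
      by (intro hull_minimal convex_Times) (auto simp: mem_Times_iff fst_curve upper.X_le_iff)
    then show "x1 G e ?sR \<le> fst x" "fst x \<le> x1 G e ?sL" using hull by auto
  qed
  have hx: "upper.height ?sR x \<ge> 0"
  proof -
    have "convex hull {G t0 0, w_L G t0 e, w_R G t0 e} \<subseteq> {p. upper.height ?sR p \<ge> 0}"
      using height_s_R[of t0] upper_height_nonneg
      by (intro hull_minimal upper.convex_above_tangent) (auto simp: w_L_def w_R_def)
    then show ?thesis using hull by blast
  qed
  obtain s0 where s0: "?sR \<le> s0" "s0 \<le> ?sL" "x1 G e s0 = fst x"
    using IVT'[of "x1 G e" ?sR "fst x" ?sL] fstx s_R_less_s_L[of t0] upper.X_cont by auto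
  \<comment> \<open>At the abscissa of \<open>x\<close> itself the tangent passes through the upper curve, and \<open>x\<close> is not above it.\<close>
  have "upper.height s0 x \<le> 0"
  proof (rule ccontr)
    assume "\<not> ?thesis"
    then have "snd x > x2 G e s0" using s0(3) by (simp add: upper.height_def)
    then have "x \<in> Xi G e" unfolding Xi_def using s0(3) by (metis (mono_tags, lifting) mem_Collect_eq prod.collapse)
    then show False using nXi by simp
  qed
  then obtain s where s: "?sR \<le> s" "s \<le> s0" "upper.height s x = 0"
    using IVT2'[of "\<lambda>s. upper.height s x" s0 0 ?sR] hx s0(1) upper.height_cont by blast
  have Xs: "x1 G e s \<le> fst x" using s(2) s0(3) upper.X_le_iff by metis
  have sL: "s \<le> ?sL" using s(2) s0(2) by simp
  obtain t1 where t1: "x1 G e ?sL < x1 G 0 t1" "upper.height ?sL (G t1 0) = 0"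
    by (rule tangent_chord[OF height_s_L[of t0]]) blast
  have up: "upper.height s (G t1 0) \<ge> 0"
    using upper.height_decreasing[of s ?sL "G t1 0"] sL t1
    by (cases "s = ?sL") (auto simp: fst_curve)
  obtain u0 where u0: "x1 G 0 u0 = x1 G e s" "x2 G 0 u0 < x2 G e s"
    using upper_above_lower by blast
  have low0: "upper.height s (G u0 0) < 0"
    using u0 by (simp add: upper.height_def fst_curve snd_curve)
  have lowt0: "upper.height s (G t0 0) \<le> 0"
  proof (cases "x1 G e s \<le> x1 G 0 t0")
    case True
    then show ?thesis
      using upper.height_decreasing[of ?sR s "G t0 0"] height_s_R[of t0] s(1)
      by (cases "s = ?sR") (auto simp: fst_curve)
  next
    case False
    then show ?thesis
      using upper.height_increasing[of s ?sL "G t0 0"] height_s_L[of t0] sL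
      by (cases "s = ?sL") (auto simp: fst_curve)
  qed
  have "u0 \<le> t1" "t0 \<le> t1"
  proof -
    have "x1 G 0 u0 \<le> x1 G 0 t1" using u0(1) sL t1(1) upper.X_le_iff[of s ?sL] by simp
    then show "u0 \<le> t1" by (simp add: lower.X_le_iff)
    have "x1 G 0 t0 \<le> x1 G 0 t1" using w_L_right[of t0] t1(1) by simp
    then show "t0 \<le> t1" by (simp add: lower.X_le_iff)
  qed
  then have le: "max u0 t0 \<le> t1" by simp
  have hc: "continuous_on A (\<lambda>u. upper.height s (G u 0))" for A
    unfolding height_eq by (intro continuous_intros lower.X_cont lower.Y_cont)
  have low: "upper.height s (G (max u0 t0) 0) \<le> 0"
    using low0 lowt0 by (simp add: max_def)
  \<comment> \<open>Searching only from \<open>u0\<close> on keeps the zero on the right of the tangency point.\<close>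
  obtain t where t: "max u0 t0 \<le> t" "t \<le> t1" "upper.height s (G t 0) = 0"
    using IVT'[of "\<lambda>u. upper.height s (G u 0)" "max u0 t0" 0 t1, OF low up le hc] by blast
  have "u0 \<noteq> t" using low0 t(3) by auto
  then have Xt: "x1 G e s < x1 G 0 t" using t(1) u0(1) lower.X_less_iff[of u0 t] by simp
  then have st: "s = s_R G t e" using s_R_unique[OF t(3)] by simp
  have "tangent_slope G e s < tangent_slope G 0 t"
    unfolding st by (rule right_chord[of t])
  moreover have "(tangent_slope G e s - tangent_slope G 0 t) * (fst x - x1 G 0 t) \<ge> 0"
    using Omega_above_lower[of x t] x t(3) s(3)
    unfolding lower.height_def upper.height_def fst_curve snd_curve by (simp add: algebra_simps)
  ultimately have "fst x \<le> x1 G 0 t" by (simp add: zero_le_mult_iff)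
  then have "x \<in> convex hull {G t 0, w_R G t e}"
    using height_on_tangent[of s "w_R G t e" "G t 0" x] height_w_R[of t] t(3) s(3) Xs Xt
    by (simp add: st fst_curve insert_commute)
  then obtain r where r: "0 \<le> r" "r \<le> 1" "x = (1 - r) *\<^sub>R G t 0 + r *\<^sub>R w_R G t e"
    unfolding segment_convex_hull[symmetric] closed_segment_def by blast
  moreover have "r \<noteq> 0" using r(3) x by (auto simp: fixed_boundary_def)
  ultimately show ?thesis using that[of r t] by (metis order_le_less)
qed

section \<open>Admissibility of monotone functions\<close>

text \<open>
  The hypothesis \<open>initial\<close> says that initial averages stay on right tangents. For an average over \<open>[c, d]\<close> the hypothesis
  \<open>final\<close> at \<open>c\<close> provides a right tangent below it. A right tangent above it is the one belonging to \<open>d\<close>: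
  along \<open>[a, d]\<close> the height of the values of the function over this tangent is first nonnegative and then
  nonpositive, and its mean is zero, so its mean over any final piece \<open>[c, d]\<close> is nonpositive.
\<close>

lemma monotone_function_admissible:
  assumes ab: "a < b" and mono: "mono_on {a..b} U"
    and int: "set_integrable lborel {a..b} (\<lambda>z. G (U z) 0)"
    and initial: "\<And>d. a < d \<Longrightarrow> d \<le> b \<Longrightarrow>
      \<exists>\<tau>. U d \<le> \<tau> \<and> upper.height (s_R G \<tau> e) (average a d (\<lambda>z. G (U z) 0)) = 0"
    and final: "\<And>c. a \<le> c \<Longrightarrow> c < b \<Longrightarrow>
      \<exists>\<tau>. \<forall>z\<in>{c..b}. upper.height (s_R G \<tau> e) (G (U z) 0) \<ge> 0"
  shows "admissible G e a b (\<lambda>z. G (U z) 0)"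
  unfolding admissible_def
proof (intro conjI int ballI allI impI)
  fix t show "G (U t) 0 \<in> fixed_boundary G" by (auto simp: fixed_boundary_def)
next
  fix c d assume cd: "a \<le> c \<and> c < d \<and> d \<le> b"
  let ?\<phi> = "\<lambda>z. G (U z) 0"
  let ?m = "average c d ?\<phi>"
  have m: "(?\<phi> has_integral (d - c) *\<^sub>R ?m) {c..d}"
    by (rule has_integral_average[OF int]) (use cd in auto)
  obtain p where p: "\<forall>z\<in>{c..b}. upper.height (s_R G p e) (G (U z) 0) \<ge> 0"
    using final[of c] cd by auto
  have pm: "upper.height (s_R G p e) ?m \<ge> 0"
    by (rule upper.height_average_nonneg[OF m]) (use p cd in auto)
  obtain q where q: "U d \<le> q" "upper.height (s_R G q e) (average a d ?\<phi>) = 0"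
    using initial[of d] cd by auto
  have Uq: "U z \<le> q" if "a \<le> z" "z \<le> d" for z
    using mono_onD[OF mono, of z d] that cd q(1) by auto
  obtain t1 where t1: "\<And>u. t1 < u \<Longrightarrow> u < q \<Longrightarrow> upper.height (s_R G q e) (G u 0) < 0"
    "\<And>u. u < t1 \<Longrightarrow> upper.height (s_R G q e) (G u 0) > 0" "upper.height (s_R G q e) (G t1 0) = 0"
    by (rule right_chord[of q]) blast
  have qm: "upper.height (s_R G q e) ?m \<le> 0"
  proof (cases "c = a")
    case True then show ?thesis using q(2) by simp
  next
    case False
    then have ac: "a < c" using cd by simp
    show ?thesis
    proof (cases "U c \<le> t1")
      case True
      have ma: "(?\<phi> has_integral (c - a) *\<^sub>R average a c ?\<phi>) {a..c}"
        by (rule has_integral_average[OF int]) (use cd ac in auto)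
      have md: "(?\<phi> has_integral (d - a) *\<^sub>R average a d ?\<phi>) {a..d}"
        by (rule has_integral_average[OF int]) (use cd in auto)
      have "U z \<le> t1" if "a \<le> z" "z \<le> c" for z
        using mono_onD[OF mono, of z c] that cd True by auto
      then have "upper.height (s_R G q e) (G (U z) 0) \<ge> 0" if "a \<le> z" "z \<le> c" for z
        using t1(2)[of "U z"] t1(3) that by (metis less_eq_real_def)
      then have "upper.height (s_R G q e) (average a c ?\<phi>) \<ge> 0"
        by (intro upper.height_average_nonneg[OF ma ac])
      moreover have "(c - a) * upper.height (s_R G q e) (average a c ?\<phi>) + (d - c) * upper.height (s_R G q e) ?m
          = (d - a) * upper.height (s_R G q e) (average a d ?\<phi>)"
        by (rule has_integral_unique[OF has_integral_combine[OF _ _ upper.height_has_integral[OF ma]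
              upper.height_has_integral[OF m]] upper.height_has_integral[OF md]]) (use ac cd in auto)
      ultimately have "(d - c) * upper.height (s_R G q e) ?m \<le> 0"
        using q(2) ac by (simp add: add_eq_0_iff)
      then show ?thesis using cd by (simp add: mult_le_0_iff)
    next
      case False
      have "upper.height (s_R G q e) (G (U z) 0) \<le> 0" if "c \<le> z" "z \<le> d" for z
      proof -
        have "t1 < U z" using mono_onD[OF mono, of c z] that cd False by auto
        moreover have "U z \<le> q" using Uq that cd by auto
        ultimately show ?thesis
          using t1(1)[of "U z"] height_s_R[of q] by (cases "U z = q") (auto simp: less_imp_le)
      qed
      then show ?thesis by (intro upper.height_average_nonpos[OF m]) (use cd in auto)
    qed
  qed
  have "continuous_on UNIV (\<lambda>\<tau>. upper.height (s_R G \<tau> e) ?m)"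
    by (rule continuous_along_s_R[OF upper.height_cont])
  then obtain \<tau> where "upper.height (s_R G \<tau> e) ?m = 0"
    using zero_between pm qm by blast
  moreover have "lower.height u ?m \<ge> 0" for u
    by (rule lower.height_average_nonneg[OF m]) (use cd lower_height_nonneg in auto)
  ultimately show "?m \<in> Omega G e" using chord_in_Omega by blast
qed

section \<open>Test functions carried by the right tangents\<close>

lemma right_of_chord: "\<tau> \<le> u \<Longrightarrow> upper.height (s_R G \<tau> e) (G u 0) \<ge> 0"
proof -
  assume "\<tau> \<le> u"
  moreover have "upper.height (s_R G \<tau> e) (G u 0) > 0" if "u > \<tau>"
    using that by (rule_tac right_chord[of \<tau>]) blast
  ultimately show ?thesis using height_s_R[of \<tau>] by (cases "u = \<tau>") (auto simp: less_imp_le)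
qed

text \<open>
  The function \<open>\<theta>\<close> in the proof is the total mass placed until the parameter has reached a given value, shifted by
  \<open>a\<close>; it solves \<open>\<theta>' = \<lambda> (\<theta> - a)\<close>, and \<open>W\<close> is its inverse. The last conclusion, with the integral over
  \<open>[a, c]\<close> supplied by a function of mean \<open>w_R G n e\<close>, says that the mean over \<open>[a, d]\<close> is
  \<open>w_R G (W d) e\<close>.
\<close>

lemma tangent_spiral:
  assumes "n < V" "a < b"
    and C: "(\<integral>\<^sup>+t\<in>{..V}. ennreal (lambda_R G e t) \<partial>lborel) \<le> ennreal C" "0 \<le> C"
  obtains c W where "a < c" "c < b" "(b - a) * exp (- C) \<le> c - a" "mono_on {c..b} W"
    "W c = n" "W b = V" "\<And>z. z \<in> {c..b} \<Longrightarrow> W z \<in> {n..V}"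
    "\<And>d. c \<le> d \<Longrightarrow> d \<le> b \<Longrightarrow> ((\<lambda>z. G (W z) 0) has_integral
        ((d - a) *\<^sub>R w_R G (W d) e - (c - a) *\<^sub>R w_R G n e)) {c..d}"
proof -
  let ?l = "lambda_R G e"
  \<comment> \<open>A slightly larger interval, so that the derivatives at \<open>n\<close> and \<open>V\<close> are two-sided.\<close>
  obtain F where F: "\<And>t. t \<in> {n - 1..V + 1} \<Longrightarrow>
      (F has_vector_derivative ?l t) (at t within {n - 1..V + 1})"
    using antiderivative_continuous[OF lambda_R_cont] by blast
  have Fd: "(F has_real_derivative ?l t) (at t)" if "n \<le> t" "t \<le> V" for t
  proof -
    have "(F has_real_derivative ?l t) (at t within {n - 1..V + 1})"
      using F[of t] that by (simp add: has_real_derivative_iff_has_vector_derivative)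
    then show ?thesis using that by (simp add: at_within_Icc_at)
  qed
  define \<theta> where "\<theta> t = a + (b - a) * exp (F t - F V)" for t
  have \<theta>d: "(\<theta> has_real_derivative (\<theta> t - a) * ?l t) (at t)" if "n \<le> t" "t \<le> V" for t
    unfolding \<theta>_def[abs_def] using Fd[OF that]
    by (auto intro!: derivative_eq_intros simp: algebra_simps)
  have \<theta>a: "\<theta> t > a" for t using assms(2) by (simp add: \<theta>_def)
  have \<theta>less: "\<theta> u < \<theta> t" if "n \<le> u" "u < t" "t \<le> V" for u t
    using that(2)
  proof (rule DERIV_pos_imp_increasing)
    fix z assume "u \<le> z" "z \<le> t"
    then show "\<exists>y. (\<theta> has_real_derivative y) (at z) \<and> 0 < y"
      using \<theta>d[of z] that \<theta>a[of z] lambda_R_pos[of z] by (intro exI[of _ "(\<theta> z - a) * ?l z"]) simp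
  qed
  have \<theta>inj: "inj_on \<theta> {n..V}"
    by (rule inj_onI) (metis \<theta>less atLeastAtMost_iff less_irrefl linorder_neqE_linordered_idom)
  have \<theta>c: "continuous_on {n..V} \<theta>"
    using \<theta>d by (intro continuous_at_imp_continuous_on ballI) (auto intro: DERIV_isCont)
  define c where "c = \<theta> n"
  have \<theta>V: "\<theta> V = b" by (simp add: \<theta>_def)
  have img: "\<theta> ` {n..V} = {c..b}"
  proof
    show "\<theta> ` {n..V} \<subseteq> {c..b}"
      using \<theta>less \<theta>V unfolding c_def by (force simp: order_le_less)
    show "{c..b} \<subseteq> \<theta> ` {n..V}"
    proof
      fix z assume z: "z \<in> {c..b}"
      obtain t where "n \<le> t" "t \<le> V" "\<theta> t = z"
        using IVT'[OF _ _ _ \<theta>c, of z] z assms(1) \<theta>V by (auto simp: c_def)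
      then show "z \<in> \<theta> ` {n..V}" by auto
    qed
  qed
  define W where "W = the_inv_into {n..V} \<theta>"
  have W\<theta>: "W (\<theta> t) = t" if "t \<in> {n..V}" for t
    unfolding W_def by (rule the_inv_into_f_f[OF \<theta>inj that])
  have \<theta>W: "\<theta> (W z) = z" if "z \<in> {c..b}" for z
    unfolding W_def using f_the_inv_into_f[OF \<theta>inj] that img by blast
  have Wr: "W z \<in> {n..V}" if "z \<in> {c..b}" for z
    using that W\<theta> unfolding img[symmetric] by auto
  have Wc: "continuous_on {c..b} W"
    unfolding img[symmetric] by (rule continuous_on_inv[OF \<theta>c]) (use W\<theta> in auto)
  have Wm: "mono_on {c..b} W"
  proof (rule mono_onI)
    fix z w assume zw: "z \<in> {c..b}" "w \<in> {c..b}" "z \<le> w"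
    show "W z \<le> W w"
    proof (rule ccontr)
      assume "\<not> W z \<le> W w"
      then have "\<theta> (W w) < \<theta> (W z)" using \<theta>less Wr zw by auto
      then show False using \<theta>W zw by simp
    qed
  qed
  have Wd: "(W has_real_derivative inverse ((z - a) * ?l (W z))) (at z)" if "c < z" "z < b" for z
  proof (rule DERIV_inverse_function[where f = \<theta> and a = c and b = b])
    show "(\<theta> has_real_derivative (z - a) * ?l (W z)) (at (W z))"
      using \<theta>d[of "W z"] \<theta>W[of z] Wr[of z] that by simp
    show "(z - a) * ?l (W z) \<noteq> 0"
      using that \<theta>a[of n] lambda_R_pos[of "W z"] by (simp add: c_def)
    show "isCont W z"
      using Wc that by (simp add: continuous_on_interior)
  qed (use that \<theta>W in auto)
  have Fle: "F V - F n \<le> C"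
  proof -
    have meas: "?l \<in> borel_measurable borel"
      by (rule borel_measurable_continuous_onI[OF lambda_R_cont])
    have "ennreal (F V - F n) = (\<integral>\<^sup>+t. ennreal (?l t) * indicator {n..V} t \<partial>lborel)"
      using Fd lambda_R_pos assms(1) meas
      by (intro nn_integral_FTC_Icc[symmetric]) (auto intro: less_imp_le has_field_derivative_at_within)
    also have "\<dots> \<le> (\<integral>\<^sup>+t\<in>{..V}. ennreal (?l t) \<partial>lborel)"
      by (intro nn_integral_mono) (auto split: split_indicator)
    also have "\<dots> \<le> ennreal C" by (rule C(1))
    finally show ?thesis using C(2) by simp
  qed
  have P: "((\<lambda>z. G (W z) 0) has_integral
        ((d - a) *\<^sub>R w_R G (W d) e - (c - a) *\<^sub>R w_R G (W c) e)) {c..d}" if d: "c \<le> d" "d \<le> b" for d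
  proof (rule fundamental_theorem_of_calculus_interior[OF d(1)])
    have wc: "continuous_on UNIV (\<lambda>t. w_R G t e)"
      using w_R_deriv has_vector_derivative_continuous
      by (intro continuous_at_imp_continuous_on) blast
    have "continuous_on {c..d} (\<lambda>z. w_R G (W z) e)"
      by (rule continuous_on_compose2[OF wc continuous_on_subset[OF Wc]]) (use d in auto)
    then show "continuous_on {c..d} (\<lambda>z. (z - a) *\<^sub>R w_R G (W z) e)"
      by (intro continuous_intros)
    fix z assume z: "z \<in> {c<..<d}"
    let ?L = "?l (W z)"
    have nz: "(z - a) * ?L \<noteq> 0"
      using z \<theta>a[of n] lambda_R_pos[of "W z"] by (simp add: c_def)
    have coeff: "inverse ((z - a) * ?L) * ?L = inverse (z - a)"
      using nz by simp
    have "((\<lambda>t. w_R G t e) \<circ> W has_vector_derivative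
        inverse ((z - a) * ?L) *\<^sub>R (?L *\<^sub>R (G (W z) 0 - w_R G (W z) e))) (at z)"
      by (rule vector_diff_chain_at[OF _ w_R_deriv])
        (use Wd[of z] z d in \<open>simp add: has_real_derivative_iff_has_vector_derivative\<close>)
    then have "((\<lambda>z. w_R G (W z) e) has_vector_derivative
        inverse (z - a) *\<^sub>R (G (W z) 0 - w_R G (W z) e)) (at z)"
      unfolding o_def scaleR_scaleR coeff .
    moreover have "((\<lambda>z. z - a) has_real_derivative 1) (at z)"
      by (auto intro!: derivative_eq_intros)
    ultimately have "((\<lambda>z. (z - a) *\<^sub>R w_R G (W z) e) has_vector_derivative
        (z - a) *\<^sub>R (inverse (z - a) *\<^sub>R (G (W z) 0 - w_R G (W z) e)) + 1 *\<^sub>R w_R G (W z) e) (at z)"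
      by (intro has_vector_derivative_scaleR)
    then show "((\<lambda>z. (z - a) *\<^sub>R w_R G (W z) e) has_vector_derivative G (W z) 0) (at z)"
      using nz by simp
  qed
  have "a < c" using \<theta>a by (simp add: c_def)
  moreover have "c < b" using \<theta>less[of n V] assms(1) by (simp add: c_def \<theta>V)
  moreover have "(b - a) * exp (- C) \<le> c - a"
    using assms(2) Fle by (simp add: c_def \<theta>_def)
  moreover have "W c = n" "W b = V"
    using W\<theta>[of n] W\<theta>[of V] assms(1) by (simp_all add: c_def \<theta>V)
  ultimately show ?thesis using that[OF _ _ _ Wm] Wr P by (metis (lifting))
qed

text \<open>
  Since \<open>lambda_R\<close> is continuous, the end point of the interval of integration can be moved.
\<close>

lemma lambda_R_integral_finite:
  assumes "(\<integral>\<^sup>+t\<in>{..v}. ennreal (lambda_R G e t) \<partial>lborel) < \<infinity>"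
  obtains C where "0 \<le> C" "(\<integral>\<^sup>+t\<in>{..V}. ennreal (lambda_R G e t) \<partial>lborel) \<le> ennreal C"
proof -
  let ?l = "lambda_R G e"
  have "compact (?l ` {v..V})"
    by (intro compact_continuous_image lambda_R_cont) auto
  then obtain B where "\<forall>y\<in>?l ` {v..V}. norm y \<le> B"
    using compact_imp_bounded bounded_iff by blast
  then have B: "?l t \<le> B" if "t \<in> {v..V}" for t using that by force
  have [measurable]: "?l \<in> borel_measurable borel"
    by (rule borel_measurable_continuous_onI[OF lambda_R_cont])
  have "(\<integral>\<^sup>+t\<in>{..V}. ennreal (?l t) \<partial>lborel) \<le>
      (\<integral>\<^sup>+t. ennreal (?l t) * indicator {..v} t + ennreal B * indicator {v..V} t \<partial>lborel)"
    using B by (intro nn_integral_mono) (auto split: split_indicator intro!: ennreal_leI)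
  also have "\<dots> = (\<integral>\<^sup>+t\<in>{..v}. ennreal (?l t) \<partial>lborel) + ennreal B * emeasure lborel {v..V}"
    by (simp add: nn_integral_add nn_integral_cmult_indicator)
  also have "\<dots> < \<infinity>"
    using assms by (simp add: ennreal_mult_less_top emeasure_lborel_Icc_eq)
  finally show ?thesis
    using that[of "enn2real (\<integral>\<^sup>+t\<in>{..V}. ennreal (?l t) \<partial>lborel)"] by (simp add: less_top)
qed

lemma curve_cont: "continuous_on UNIV (\<lambda>t. G t 0)"
  using continuous_on_Pair[OF lower.X_cont lower.Y_cont] by (simp add: point_eq[symmetric])

text \<open>
  The test function takes the value \<open>g(n')\<close> up to \<open>p\<close>, then \<open>g(n)\<close> up to \<open>c\<close>, then follows the spiral up to
  \<open>m\<close>, and is \<open>g(V)\<close> in the end. Its initial averages run along the chord from \<open>g(n')\<close> to \<open>w_R G n e\<close>, then along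
  the upper curve to \<open>w_R G V e\<close>, and finally along the right tangent towards \<open>g(V)\<close>.
\<close>

lemma test_function:
  assumes ab: "a < b" and r: "0 < r" "r \<le> 1" and x: "x = (1 - r) *\<^sub>R G V 0 + r *\<^sub>R w_R G V e"
    and nV: "n < V"
    and C: "(\<integral>\<^sup>+t\<in>{..V}. ennreal (lambda_R G e t) \<partial>lborel) \<le> ennreal C" "0 \<le> C"
  obtains U c where "a < c" "c \<le> b" "r * (b - a) * exp (- C) \<le> c - a" "mono U"
    "\<And>z. U z \<le> V" "\<And>z. z < c \<Longrightarrow> U z \<le> n"
    "admissible G e a b (\<lambda>z. G (U z) 0)" "average a b (\<lambda>z. G (U z) 0) = x"
proof -
  define m where "m = a + r * (b - a)"
  have m: "a < m" "m \<le> b"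
  proof -
    have "r * (b - a) \<le> 1 * (b - a)" using ab r(2) by (intro mult_right_mono) auto
    then show "m \<le> b" by (simp add: m_def algebra_simps)
    show "a < m" using ab r(1) by (simp add: m_def)
  qed
  obtain c W where c: "a < c" "c < m" "(m - a) * exp (- C) \<le> c - a" "mono_on {c..m} W"
    "W c = n" "W m = V" "\<And>z. z \<in> {c..m} \<Longrightarrow> W z \<in> {n..V}"
    and spiral: "\<And>d. c \<le> d \<Longrightarrow> d \<le> m \<Longrightarrow> ((\<lambda>z. G (W z) 0) has_integral
        ((d - a) *\<^sub>R w_R G (W d) e - (c - a) *\<^sub>R w_R G n e)) {c..d}"
    by (rule tangent_spiral[OF nV m(1) C]) blast
  obtain n' where n': "n' < n" "x1 G 0 n' < x1 G e (s_R G n e)"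
    "upper.height (s_R G n e) (G n' 0) = 0"
    by (rule right_chord[of n]) blast
  have "w_R G n e \<in> convex hull {G n' 0, G n 0}"
    by (rule height_on_tangent[OF n'(3) height_s_R])
      (use n'(2) w_R_left[of n] height_w_R[of n] in \<open>auto simp: fst_curve\<close>)
  then obtain q where q: "0 \<le> q" "q \<le> 1" "w_R G n e = (1 - q) *\<^sub>R G n' 0 + q *\<^sub>R G n 0"
    unfolding segment_convex_hull[symmetric] closed_segment_def by blast
  \<comment> \<open>Chosen so that the two values on \<open>[a, c]\<close> have mean \<open>w_R G n e\<close>.\<close>
  define p where "p = a + (1 - q) * (c - a)"
  have p: "a \<le> p" "p \<le> c" "(p - a) *\<^sub>R G n' 0 + (c - p) *\<^sub>R G n 0 = (c - a) *\<^sub>R w_R G n e"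
  proof -
    show "a \<le> p" using q c(1) by (simp add: p_def)
    have "c - p = q * (c - a)" by (simp add: p_def algebra_simps)
    moreover have "q * (c - a) \<ge> 0" using q c(1) by simp
    ultimately show "p \<le> c" by simp
    show "(p - a) *\<^sub>R G n' 0 + (c - p) *\<^sub>R G n 0 = (c - a) *\<^sub>R w_R G n e"
      unfolding q(3) \<open>c - p = q * (c - a)\<close> by (simp add: p_def scaleR_add_right mult.commute)
  qed
  define U where "U z = (if z < p then n' else if z < c then n else if z \<le> m then W z else V)" for z
  let ?\<phi> = "\<lambda>z. G (U z) 0"
  have U_W: "U z = W z" if "c \<le> z" "z \<le> m" for z
    using that p(2) by (simp add: U_def)
  have U_init: "U z = n' \<or> U z = n" if "z \<le> c" for z
    using that c(2,5) by (auto simp: U_def)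
  have U_late: "n \<le> U z" if "p \<le> z" for z
    using that c(7)[of z] nV by (auto simp: U_def)
  have U_end: "U z = V" if "m \<le> z" for z
    using that c(2,6) p(2) by (auto simp: U_def)
  have U_V: "U z \<le> V" for z
    using c(7)[of z] nV n'(1) by (auto simp: U_def)
  have U_n': "n' \<le> U z" for z
    using U_late[of z] n'(1) by (auto simp: U_def)
  have mono: "mono U"
  proof (rule monoI)
    fix z w :: real assume zw: "z \<le> w"
    consider "z < p" | "p \<le> z" "z < c" | "c \<le> z" "w \<le> m" | "m < w" by linarith
    then show "U z \<le> U w"
    proof cases
      case 1 then show ?thesis using U_n'[of w] by (simp add: U_def)
    next
      case 2 then show ?thesis using U_late[of w] zw by (simp add: U_def)
    next
      case 3 then show ?thesis using U_W zw mono_onD[OF c(4)] by simp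
    next
      case 4 then show ?thesis using U_V[of z] U_end[of w] by simp
    qed
  qed
  have int: "set_integrable lborel {a..b} ?\<phi>"
    by (rule set_integrable_along_bounded_mono[OF mono U_n' U_V curve_cont])
  have const: "(?\<phi> has_integral (d - l) *\<^sub>R G t 0) {l..d}"
    if "l \<le> d" "\<And>z. l < z \<Longrightarrow> z < d \<Longrightarrow> U z = t" for l d t
  proof (rule has_integral_spike_finite[of "{l, d}"])
    show "((\<lambda>z. G t 0) has_integral (d - l) *\<^sub>R G t 0) {l..d}"
      using has_integral_const_real[of "G t 0" l d] that(1) by simp
  qed (use that in auto)
  have initial: "(?\<phi> has_integral (c - a) *\<^sub>R w_R G n e) {a..c}"
  proof -
    have "(?\<phi> has_integral (p - a) *\<^sub>R G n' 0 + (c - p) *\<^sub>R G n 0) {a..c}"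
      by (rule has_integral_combine[OF p(1,2) const const]) (use p in \<open>auto simp: U_def\<close>)
    then show ?thesis unfolding p(3) .
  qed
  have middle: "(?\<phi> has_integral (d - a) *\<^sub>R w_R G (W d) e) {a..d}" if d: "c \<le> d" "d \<le> m" for d
  proof -
    have "(?\<phi> has_integral ((d - a) *\<^sub>R w_R G (W d) e - (c - a) *\<^sub>R w_R G n e)) {c..d}"
      by (rule has_integral_eq[OF _ spiral[OF d]]) (use U_W d in auto)
    from has_integral_combine[OF _ d(1) initial this] c(1) show ?thesis by simp
  qed
  have last: "(?\<phi> has_integral (m - a) *\<^sub>R w_R G V e + (d - m) *\<^sub>R G V 0) {a..d}" if d: "m \<le> d" for d
    using has_integral_combine[OF _ d middle[of m] const[OF d, of V]] c(2,6) m(1) U_end by simp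
  have avg: "y = (d - a) *\<^sub>R average a d ?\<phi>" if "(?\<phi> has_integral y) {a..d}" "a < d" "d \<le> b" for y d
    using has_integral_unique[OF that(1) has_integral_average[OF int _ that(2,3)]] by simp
  have "admissible G e a b ?\<phi>"
  proof (rule monotone_function_admissible[OF ab _ int])
    show "mono_on {a..b} U" using mono by (simp add: mono_def mono_on_def)
  next
    fix d assume d: "a < d" "d \<le> b"
    consider "d \<le> c" | "c \<le> d" "d \<le> m" | "m \<le> d" by linarith
    then show "\<exists>\<tau>. U d \<le> \<tau> \<and> upper.height (s_R G \<tau> e) (average a d ?\<phi>) = 0"
    proof cases
      case 1
      have "upper.height (s_R G n e) (G (U z) 0) = 0" if "z \<le> d" for z
        using U_init[of z] that 1 n'(3) height_s_R[of n] by auto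
      moreover have I: "(?\<phi> has_integral (d - a) *\<^sub>R average a d ?\<phi>) {a..d}"
        by (rule has_integral_average[OF int]) (use d in auto)
      ultimately have "upper.height (s_R G n e) (average a d ?\<phi>) = 0"
        by (intro order_antisym upper.height_average_nonneg[OF I d(1)]
            upper.height_average_nonpos[OF I d(1)]) auto
      moreover have "U d \<le> n" using U_init[OF 1] n'(1) by auto
      ultimately show ?thesis by blast
    next
      case 2
      have "average a d ?\<phi> = w_R G (W d) e"
        using avg[OF middle[OF 2] d] d(1) by simp
      then show ?thesis using U_W[OF 2] height_w_R by auto
    next
      case 3
      define k where "k = (d - m) / (d - a)"
      have k: "d - m = (d - a) * k" "m - a = (d - a) * (1 - k)"
        using d(1) by (auto simp: k_def field_simps)
      have "(d - a) *\<^sub>R average a d ?\<phi> = (d - a) *\<^sub>R ((1 - k) *\<^sub>R w_R G V e + k *\<^sub>R G V 0)"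
        using avg[OF last[OF 3] d] unfolding k by (simp add: scaleR_add_right)
      then have "average a d ?\<phi> = (1 - k) *\<^sub>R w_R G V e + k *\<^sub>R G V 0"
        using d(1) by simp
      then have "upper.height (s_R G V e) (average a d ?\<phi>) = 0"
        using height_w_R[of V] height_s_R[of V] upper.height_affine[of "s_R G V e" k] by simp
      then show ?thesis using U_V by blast
    qed
  next
    fix l assume "a \<le> l" "l < b"
    show "\<exists>\<tau>. \<forall>z\<in>{l..b}. upper.height (s_R G \<tau> e) (G (U z) 0) \<ge> 0"
    proof (cases "l < p")
      case True
      have "upper.height (s_R G n e) (G (U z) 0) \<ge> 0" for z
        using right_of_chord[OF U_late[of z]] n'(3) by (cases "z < p") (auto simp: U_def)
      then show ?thesis by blast
    next
      case False
      have "upper.height (s_R G (U l) e) (G (U z) 0) \<ge> 0" if "l \<le> z" for z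
        by (rule right_of_chord[OF monoD[OF mono that]])
      then show ?thesis by (intro exI[of _ "U l"]) simp
    qed
  qed
  moreover have "average a b ?\<phi> = x"
  proof -
    have "m - a = (b - a) * r" "b - m = (b - a) * (1 - r)" by (simp_all add: m_def algebra_simps)
    then have "(b - a) *\<^sub>R average a b ?\<phi> = (b - a) *\<^sub>R x"
      using avg[OF last[OF m(2)] ab order_refl] unfolding x
      by (simp add: scaleR_add_right add.commute)
    then show ?thesis using ab by simp
  qed
  moreover have "U z \<le> n" if "z < c" for z
    using U_init[of z] that n'(1) by auto
  moreover have "c \<le> b" "r * (b - a) * exp (- C) \<le> c - a"
    using c(2,3) m(2) unfolding m_def by simp_all
  ultimately show thesis
    by (intro that[OF c(1) _ _ mono U_V])
qed

section \<open>The Bellman function\<close>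

lemma bellman_infinite:
  assumes f: "continuous_on UNIV f" "filterlim f at_top at_bot"
    and l: "(\<integral>\<^sup>+t\<in>{..v}. ennreal (lambda_R G e t) \<partial>lborel) < \<infinity>"
    and ab: "a < b" and x: "x \<in> Omega G e - fixed_boundary G"
  shows "bellman G e a b f x = \<infinity>"
proof (rule ereal_top)
  fix N :: real
  obtain V r where r: "0 < r" "r \<le> 1" "x = (1 - r) *\<^sub>R G V 0 + r *\<^sub>R w_R G V e"
    by (rule right_tangents_cover[OF x])
  obtain C where C: "0 \<le> C" "(\<integral>\<^sup>+t\<in>{..V}. ennreal (lambda_R G e t) \<partial>lborel) \<le> ennreal C"
    by (rule lambda_R_integral_finite[OF l])
  have large: "\<exists>T. \<forall>t\<le>T. K \<le> f t" for K
    using f(2) by (simp add: filterlim_at_top eventually_at_bot_linorder)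
  obtain B where B: "0 \<le> B" "\<And>t. t \<le> V \<Longrightarrow> - B \<le> f t"
  proof -
    obtain T where T: "\<forall>t\<le>T. 0 \<le> f t" using large by blast
    have "compact (f ` {T..V})"
      by (intro compact_continuous_image continuous_on_subset[OF f(1)]) auto
    then obtain B where "\<forall>y\<in>f ` {T..V}. norm y \<le> B"
      using compact_imp_bounded bounded_iff by blast
    then have B: "\<bar>f t\<bar> \<le> B" if "t \<in> {T..V}" for t using that by force
    have "- max 0 B \<le> f t" if "t \<le> V" for t
      using T B[of t] that by (cases "t \<le> T") auto
    then show ?thesis using that[of "max 0 B"] by simp
  qed
  \<comment> \<open>The initial piece takes up at least the fraction \<open>r * exp (- C)\<close> of \<open>[a, b]\<close>, independently of \<open>n\<close>;
  this \<open>M\<close> compensates for the lower bound \<open>- B\<close> on the rest.\<close>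
  define M where "M = max 0 ((N + B) / (r * exp (- C)))"
  obtain T where T: "\<forall>t\<le>T. M \<le> f t" using large by blast
  define n where "n = min T (V - 1)"
  have n: "n < V" "\<And>t. t \<le> n \<Longrightarrow> M \<le> f t" using T by (auto simp: n_def)
  obtain U c where U: "a < c" "c \<le> b" "r * (b - a) * exp (- C) \<le> c - a" "mono U"
    "\<And>z. U z \<le> V" "\<And>z. z < c \<Longrightarrow> U z \<le> n"
    and adm: "admissible G e a b (\<lambda>z. G (U z) 0)" "average a b (\<lambda>z. G (U z) 0) = x"
    by (rule test_function[OF ab r n(1) C(2,1)]) blast
  let ?h = "\<lambda>z. on_boundary G f (G (U z) 0)"
  have "(THE t. G t 0 = G u 0) = u" for u
    by (rule the_equality) (auto simp: point_eq lower.X_eq_iff)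
  then have h: "on_boundary G f (G u 0) = f u" for u by (simp add: on_boundary_def)
  have meas: "?h \<in> borel_measurable borel"
    unfolding h
    by (rule measurable_compose[OF borel_measurable_mono[OF U(4)] borel_measurable_continuous_onI[OF f(1)]])
  have avg: "has_ext_average a b ?h" "ereal ((M * (c - a) - B * (b - a)) / (b - a)) \<le> ext_average a b ?h"
  proof -
    have M: "0 \<le> M" "\<And>z. z < c \<Longrightarrow> M \<le> ?h z" using U(6) n(2) by (auto simp: h) (simp add: M_def)
    have "- B \<le> ?h z" for z using U(5) B(2) by (simp add: h)
    then show "has_ext_average a b ?h"
      "ereal ((M * (c - a) - B * (b - a)) / (b - a)) \<le> ext_average a b ?h"
      using ext_average_bounds[OF ab less_imp_le[OF U(1)] U(2) M(1) B(1) meas M(2)] by blast+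
  qed
  have "N * (b - a) \<le> M * (c - a) - B * (b - a)"
  proof -
    have "N + B \<le> M * (r * exp (- C))"
      using r(1) by (simp add: M_def field_simps max_def)
    then have "(N + B) * (b - a) \<le> M * (r * exp (- C)) * (b - a)"
      using ab by (intro mult_right_mono) auto
    also have "\<dots> = M * (r * (b - a) * exp (- C))" by simp
    also have "\<dots> \<le> M * (c - a)" using U(3) by (intro mult_left_mono) (auto simp: M_def)
    finally show ?thesis by (simp add: algebra_simps)
  qed
  then have "ereal N \<le> ereal ((M * (c - a) - B * (b - a)) / (b - a))"
    using ab by (simp add: pos_le_divide_eq)
  also have "\<dots> \<le> ext_average a b ?h" by (rule avg(2))
  also have "\<dots> \<le> bellman G e a b f x"
    unfolding bellman_def using adm avg(1)
    by (intro Sup_upper CollectI exI[of _ "\<lambda>z. G (U z) 0"]) simp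
  finally show "ereal N \<le> bellman G e a b f x" .
qed

end

theorem proposition5p4p10:
  fixes G :: curves and emax :: ereal and e v :: real and f :: "real \<Rightarrow> real"
    and a b :: real and x :: "real \<times> real"
  assumes "domain_family G emax"
    and "0 < e" and "ereal e < emax"
    and "regular_boundary_value G f"
    and "(\<integral>\<^sup>+t\<in>{..v}. ennreal (lambda_R G e t) \<partial>lborel) < \<infinity>"
    and "filterlim f at_top at_bot"
    and "a < b"
    and "x \<in> Omega G e - fixed_boundary G"
  shows "bellman G e a b f x = \<infinity>"
proof -
  interpret domain_at G emax e
    using assms(1-3) by (simp add: domain_at_def domain_at_axioms_def)
  have "f differentiable_on UNIV"
    using assms(4) unfolding regular_boundary_value_def by (rule conjunct1)
  then have "continuous_on UNIV f"
    by (rule differentiable_imp_continuous_on)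
  from bellman_infinite[OF this assms(6,5,7,8)] show ?thesis .
qed

end
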